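(* Let $N\ge 1$ and let $\alpha=(\alpha_1,\ldots,\alpha_k)$ be a composition of $m\le 2N$ of length $k$. Then $$H_N^{\alpha}(t+k)=N\sum_{r=0}^{\min(2N-m,\,N-k+1)}\binom{t}{r}\binom{2N+k-1}{2N-m-r}2^{k+r-N}\frac{(2N-k-r)!}{(N-k-r+1)!}.$$ Consequently, $$\sigma_{2^N}^{\alpha}=\frac{\prod_{i=1}^k\alpha_i!}{(2N-1)!\,(2N-1)!!}\sum_{r=0}^{\min(2N-m,\,N-k+1)}\binom{1-k}{r}\binom{2N+k-1}{2N-m-r}2^{k+r-N-1}\frac{(2N-k-r)!}{(N-k-r+1)!}.$$
   Context: Permutations are composed as functions: $(\pi\circ\rho)(i)=\pi(\rho(i))$. For a composition $\alpha=(\alpha_1,\ldots,\alpha_k)$ of $m\le 2N$, $\mathcal A_{2N}^\alpha$ is the set of tuples $A=(A_1,\ldots,A_k)$ of pairwise disjoint subsets of $[2N]$ with $\#A_i=\alpha_i$; a permutation is $A$-separated if no cycle of it contains elements of more than one set $A_i$. $\mathcal S_{2^N}^\alpha$ is the set of pairs $(\pi,A)$ with $\pi$ a fixed-point-free involution of $[2N]$ and $A\in\mathcal A_{2N}^\alpha$ such that $\pi\circ(1,2,\ldots,2N)$ is $A$-separated; $\mathrm{uc}(\pi,A)$ is the number of cycles of $\pi\circ(1,2,\ldots,2N)$ containing no element of $A_1\cup\cdots\cup A_k$. $H_N^\alpha(t)=\sum_{(\pi,A)\in\mathcal S_{2^N}^\alpha}t^{\mathrm{uc}(\pi,A)}$.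 $\binom{x}{r}=x(x-1)\cdots(x-r+1)/r!$. $\sigma_{2^N}^\alpha$ is the probability that the product of a uniformly random fixed-point-free involution of $[2N]$ with a uniformly random $2N$-cycle is $A$-separated, for a fixed $A\in\mathcal A_{2N}^\alpha$.
   Formalization: The printed formula for σ lacks a factor (2N−m)! in the numerator of its prefactor (for N=2, α=(1) it gives 1/6, while σ=1); the formal statement proves it with this factor. The first formula is as printed. *)

theory Defs
  imports "HOL-Combinatorics.Combinatorics" "HOL-Probability.Probability_Mass_Function"
begin

abbreviation points :: "nat \<Rightarrow> nat set" where
  "points N \<equiv> {1..2 * N}"

definition composition :: "nat list \<Rightarrow> nat \<Rightarrow> nat \<Rightarrow> bool" where
  "composition \<alpha> m k \<longleftrightarrow> length \<alpha> = k \<and> (\<forall>a\<in>set \<alpha>. a > 0) \<and> sum_list \<alpha> = m"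

definition set_tuples :: "nat \<Rightarrow> nat list \<Rightarrow> nat set list set" where
  "set_tuples N \<alpha> = {A. length A = length \<alpha> \<and>
     (\<forall>i<length A. A ! i \<subseteq> points N \<and> card (A ! i) = \<alpha> ! i) \<and>
     (\<forall>i<length A. \<forall>j<length A. i \<noteq> j \<longrightarrow> A ! i \<inter> A ! j = {})}"

text \<open>The cycles of a permutation of a finite set \<open>S\<close>, as subsets of \<open>S\<close>; a fixed point
  is a cycle of length one.\<close>

definition cycles_of :: "(nat \<Rightarrow> nat) \<Rightarrow> nat set \<Rightarrow> nat set set" where
  "cycles_of \<pi> S = orbit \<pi> ` S"

definition separated :: "nat \<Rightarrow> nat set list \<Rightarrow> (nat \<Rightarrow> nat) \<Rightarrow> bool" where
  "separated N A \<pi> \<longleftrightarrow>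
     (\<forall>C\<in>cycles_of \<pi> (points N). \<forall>i<length A. \<forall>j<length A.
        C \<inter> A ! i \<noteq> {} \<and> C \<inter> A ! j \<noteq> {} \<longrightarrow> i = j)"

definition fpf_involutions :: "nat \<Rightarrow> (nat \<Rightarrow> nat) set" where
  "fpf_involutions N = {\<pi>. \<pi> permutes points N \<and> (\<forall>x\<in>points N. \<pi> (\<pi> x) = x \<and> \<pi> x \<noteq> x)}"

definition long_cycles :: "nat \<Rightarrow> (nat \<Rightarrow> nat) set" where
  "long_cycles N = {c. c permutes points N \<and> cyclic_on c (points N)}"

text \<open>The permutation \<open>(1, 2, \<dots>, 2N)\<close>, which maps \<open>i\<close> to \<open>i + 1\<close> and \<open>2N\<close> to \<open>1\<close>.\<close>

definition std_cycle :: "nat \<Rightarrow> nat \<Rightarrow> nat" where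
  "std_cycle N = cycle_of_list [1..<2 * N + 1]"

definition separated_pairs :: "nat \<Rightarrow> nat list \<Rightarrow> ((nat \<Rightarrow> nat) \<times> nat set list) set" where
  "separated_pairs N \<alpha> = {(\<pi>, A). \<pi> \<in> fpf_involutions N \<and> A \<in> set_tuples N \<alpha> \<and>
     separated N A (\<pi> \<circ> std_cycle N)}"

definition uc :: "nat \<Rightarrow> (nat \<Rightarrow> nat) \<Rightarrow> nat set list \<Rightarrow> nat" where
  "uc N \<pi> A = card {C \<in> cycles_of (\<pi> \<circ> std_cycle N) (points N). C \<inter> \<Union>(set A) = {}}"

definition H :: "nat \<Rightarrow> nat list \<Rightarrow> 'a :: field_char_0 \<Rightarrow> 'a" where
  "H N \<alpha> t = (\<Sum>(\<pi>, A)\<in>separated_pairs N \<alpha>. t ^ uc N \<pi> A)"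

definition sep_prob :: "nat \<Rightarrow> nat set list \<Rightarrow> real" where
  "sep_prob N A =
     measure_pmf.prob (pair_pmf (pmf_of_set (fpf_involutions N)) (pmf_of_set (long_cycles N)))
       {(\<pi>, c). separated N A (\<pi> \<circ> c)}"

fun double_fact :: "nat \<Rightarrow> nat" where
  "double_fact 0 = 1"
| "double_fact (Suc 0) = 1"
| "double_fact (Suc (Suc n)) = Suc (Suc n) * double_fact n"

end

theory Submission
  imports Defs
begin

text \<open>
  For a natural number \<open>T\<close>, \<open>H(T + k)\<close> counts triples of a matching \<open>\<pi>\<close>, a tuple \<open>A\<close> and a colouring \<open>f\<close>
  of the points with \<open>k + T\<close> colours that is constant on the cycles of \<open>\<pi> \<circ> (1, \<dots>, 2N)\<close> and has colour \<open>i\<close> on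
  \<open>A\<^sub>i\<close>. Read cyclically, \<open>f\<close> is a closed walk on the colours in which \<open>\<pi>\<close> pairs every step with a reversed
  step. As in the BEST theorem, such pairs with prescribed colour multiplicities \<open>\<gamma>\<close> correspond to matchings of
  darts for which the last exits from the vertices other than the starting one form an arborescence towards
  it. Contracting one last exit at a time counts these matchings, and the number of pairs turns out to
  depend only on \<open>N\<close> and on the number \<open>l\<close> of colours used: it is
  \<open>N (2N - l)! 2^(l - N) / (N - l + 1)!\<close>. It remains to sum the products of the \<open>binom(\<gamma>\<^sub>i, \<alpha>\<^sub>i)\<close> over all
  \<open>\<gamma>\<close> with sum \<open>2N\<close>, and to extend from natural \<open>T\<close> to all \<open>t\<close> since both sides are polynomials. The
  separation probability is an average over \<open>A\<close>, by conjugation, so it is read off from \<open>H(1)\<close>.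
\<close>

section \<open>Perfect matchings and arborescences\<close>

text \<open>The probability needs \<open>t = 1 - k\<close>, which is negative for
  \<open>k > 1\<close>, so no number of colours realises it directly; hence the detour through a
  polynomial identity. The shift by \<open>k\<close> reserves one colour for each block. A reserved
  colour is always used, since the binomial of 0 over a positive part vanishes. So
  \<open>l = k + r\<close>, where \<open>r\<close> counts the unreserved colours in use, and
  \<open>binom(t, r)\<close> chooses them. That the count ignores the multiplicities has a simple
  cause. For walks starting at a fixed colour it is the multiplicity of that colour times a number
  free of all multiplicities, because in each contraction the multiplicity of the vertex that
  disappears cancels. Summing over the starting colour replaces the remaining multiplicity by the
  total \<open>2N\<close>; this \<open>2N\<close> becomes the factor \<open>N\<close> and one power
  of 2. Two averages enter the probability. Conjugation makes it independent of \<open>A\<close>, so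
  \<open>A\<close> may vary; conjugation again allows the random long cycle to be fixed as the
  standard one. The number of tuples is a multinomial coefficient, in which \<open>(2N - m)!\<close>
  accounts for the points outside all blocks.\<close>

definition matchings :: "'b set \<Rightarrow> ('b \<Rightarrow> 'b) set" where
  "matchings D = {\<mu>. \<mu> permutes D \<and> (\<forall>x\<in>D. \<mu> (\<mu> x) = x \<and> \<mu> x \<noteq> x)}"

lemma matchingsD:
  assumes "\<mu> \<in> matchings D"
  shows "\<mu> permutes D" "x \<in> D \<Longrightarrow> \<mu> x \<in> D" "x \<in> D \<Longrightarrow> \<mu> (\<mu> x) = x" "x \<in> D \<Longrightarrow> \<mu> x \<noteq> x" "x \<notin> D \<Longrightarrow> \<mu> x = x"
  using assms permutes_in_image[of \<mu> D x] by (auto simp: matchings_def permutes_def)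

lemma matchingsI:
  assumes "\<And>x. x \<in> D \<Longrightarrow> \<mu> x \<in> D" "\<And>x. x \<in> D \<Longrightarrow> \<mu> (\<mu> x) = x" "\<And>x. x \<in> D \<Longrightarrow> \<mu> x \<noteq> x" "\<And>x. x \<notin> D \<Longrightarrow> \<mu> x = x"
  shows "\<mu> \<in> matchings D"
proof -
  have "bij_betw \<mu> D D"
    by (rule bij_betw_byWitness[where f' = \<mu>]) (use assms in auto)
  then show ?thesis using assms by (auto simp: matchings_def intro: bij_imp_permutes)
qed

lemma finite_matchings: "finite D \<Longrightarrow> finite (matchings D)"
  by (rule finite_subset[OF _ finite_permutations[of D]]) (auto simp: matchings_def)

text \<open>A matching of \<open>D - {e, t}\<close> fixes \<open>e\<close> and \<open>t\<close>, so
  composing it with the transposition adds exactly the pair of \<open>e\<close> and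
  \<open>t\<close>; conversely \<open>t\<close> is the partner of \<open>e\<close>. The predicate is
  carried along because the contraction argument rewrites it separately for each
  \<open>t\<close>.\<close>

lemma card_matchings_split:
  assumes fin: "finite D" and e: "e \<in> D"
  shows "card {\<mu>\<in>matchings D. P \<mu>} =
    (\<Sum>t\<in>D - {e}. card {\<nu>\<in>matchings (D - {e, t}). P (\<nu> \<circ> Transposition.transpose e t)})"
proof -
  have "bij_betw (\<lambda>(t, \<nu>). \<nu> \<circ> Transposition.transpose e t)
      (SIGMA t:D - {e}. {\<nu>\<in>matchings (D - {e, t}). P (\<nu> \<circ> Transposition.transpose e t)}) {\<mu>\<in>matchings D. P \<mu>}"
  proof (rule bij_betw_byWitness[where f' = "\<lambda>\<mu>. (\<mu> e, \<mu> \<circ> Transposition.transpose e (\<mu> e))"]; safe)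
    fix t \<nu> assume t: "t \<in> D" "t \<noteq> e" and \<nu>: "\<nu> \<in> matchings (D - {e, t})"
    note m = matchingsD[OF \<nu>]
    have et: "\<nu> e = e" "\<nu> t = t" using m(5) by auto
    show "(\<nu> \<circ> Transposition.transpose e t) e = t" using et by simp
    show "\<nu> \<circ> Transposition.transpose e t \<circ> Transposition.transpose e ((\<nu> \<circ> Transposition.transpose e t) e) = \<nu>" using et by (simp add: comp_assoc)
    show "\<nu> \<circ> Transposition.transpose e t \<in> matchings D"
    proof (rule matchingsI)
      fix x
      { assume x: "x \<in> D"
        show "(\<nu> \<circ> Transposition.transpose e t) x \<in> D" using x t e et m by (cases "x \<in> {e,t}") auto
      show "(\<nu> \<circ> Transposition.transpose e t) ((\<nu> \<circ> Transposition.transpose e t) x) = x"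
      proof (cases "x \<in> {e,t}")
        case False
        then have "\<nu> x \<notin> {e,t}" using m(2)[of x] x by auto
        then show ?thesis using False m(3)[of x] x by (auto simp: Transposition.transpose_def)
      qed (use et in auto)
      show "(\<nu> \<circ> Transposition.transpose e t) x \<noteq> x"
        using t et m(4)[of x] x by (cases "x \<in> {e,t}") auto }
      { assume "x \<notin> D" then show "(\<nu> \<circ> Transposition.transpose e t) x = x" using t e m(5)[of x]
         by (auto simp: Transposition.transpose_def) }
    qed
  next
    fix \<mu> assume \<mu>: "\<mu> \<in> matchings D"
    note m = matchingsD[OF \<mu>]
    have A: "\<mu> (\<mu> e) = e" "\<mu> e \<in> D" "\<mu> e \<noteq> e" using m e by auto
    show "\<mu> e \<in> D" by fact
    show "\<mu> e = e \<Longrightarrow> False" using A by auto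
    show "\<mu> \<circ> Transposition.transpose e (\<mu> e) \<in> matchings (D - {e, \<mu> e})"
    proof (rule matchingsI)
      fix x
      { assume x: "x \<in> D - {e, \<mu> e}"
        then have *: "(\<mu> \<circ> Transposition.transpose e (\<mu> e)) x = \<mu> x" by (auto simp: Transposition.transpose_def)
        have **: "\<mu> x \<in> D - {e, \<mu> e}" using x m(2,3)[of x] A by auto
        then show "(\<mu> \<circ> Transposition.transpose e (\<mu> e)) x \<in> D - {e, \<mu> e}" by (simp only: *)
        show "(\<mu> \<circ> Transposition.transpose e (\<mu> e)) ((\<mu> \<circ> Transposition.transpose e (\<mu> e)) x) = x"
          unfolding * using ** x m(3)[of x] by (auto simp: Transposition.transpose_def)
        show "(\<mu> \<circ> Transposition.transpose e (\<mu> e)) x \<noteq> x" unfolding * using m(4) x by auto }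
      { assume "x \<notin> D - {e, \<mu> e}"
        then show "(\<mu> \<circ> Transposition.transpose e (\<mu> e)) x = x" using A m(5)[of x] by (auto simp: Transposition.transpose_def) }
    qed
  next
    fix \<mu> assume "\<mu> \<in> matchings D" "P \<mu>"
    then show "P (\<mu> \<circ> Transposition.transpose e (\<mu> e) \<circ> Transposition.transpose e (\<mu> e))" by (simp add: comp_assoc)
  qed (auto simp: comp_assoc)
  from bij_betw_same_card[OF this, symmetric]
  show ?thesis using fin by (simp add: finite_matchings)
qed

lemma matchings_empty [simp]: "matchings {} = {id}"
  by (auto simp: matchings_def)

lemma card_matchings:
  assumes "finite D" "card D = 2 * N"
  shows "card (matchings D) = double_fact (2 * N - 1)"
  using assms
proof (induction N arbitrary: D)
  case 0
  then show ?case by simp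
next
  case (Suc N)
  then obtain e where e: "e \<in> D" by fastforce
  have "card (matchings D) = card {\<mu>\<in>matchings D. True}" by simp
  also have "\<dots> = (\<Sum>t\<in>D - {e}. card (matchings (D - {e, t})))"
    by (subst card_matchings_split[OF Suc.prems(1) e]) simp
  also have "\<dots> = (\<Sum>t\<in>D - {e}. double_fact (2 * N - 1))"
  proof (rule sum.cong[OF refl])
    fix t assume "t \<in> D - {e}"
    then have "card (D - {e, t}) = 2 * N" using Suc.prems e by (auto simp: card_Diff_subset card_insert_if)
    then show "card (matchings (D - {e, t})) = double_fact (2 * N - 1)" using Suc by simp
  qed
  also have "\<dots> = double_fact (2 * Suc N - 1)"
    using Suc.prems e by (cases N) auto
  finally show ?case .
qed

lemma double_fact_odd: "double_fact (2 * N - 1) * (2 ^ N * fact N) = (fact (2 * N) :: nat)"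
proof (induction N)
  case (Suc N)
  show ?case
  proof (cases N)
    case (Suc M)
    have "double_fact (2 * Suc N - 1) = (2 * N + 1) * double_fact (2 * N - 1)" by (simp add: Suc)
    then have "double_fact (2 * Suc N - 1) * (2 ^ Suc N * fact (Suc N)) =
      (2 * N + 2) * (2 * N + 1) * (double_fact (2 * N - 1) * (2 ^ N * fact N))"
      by (simp add: algebra_simps)
    then show ?thesis unfolding Suc.IH by (simp add: algebra_simps)
  qed auto
qed auto

text \<open>For finite \<open>J\<close>: the parent function \<open>par\<close> has no cycle inside \<open>J\<close>.\<close>

definition arborescence :: "('c \<Rightarrow> 'c) \<Rightarrow> 'c set \<Rightarrow> bool" where
  "arborescence par J \<longleftrightarrow> (\<forall>X\<subseteq>J. X \<noteq> {} \<longrightarrow> (\<exists>i\<in>X. par i \<notin> X))"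

lemma arborescence_empty [simp]: "arborescence par {}"
  by (auto simp: arborescence_def)

lemma arborescence_cong:
  "(\<And>i. i \<in> J \<Longrightarrow> p i = q i) \<Longrightarrow> arborescence p J = arborescence q J"
  unfolding arborescence_def by (metis subsetD)

text \<open>Merging \<open>i\<close> into its parent neither creates nor destroys closed sets. A set
  closed after the merge is closed before it, once \<open>i\<close> is added in case it contains
  \<open>par i\<close>. Removing \<open>i\<close> from a set closed before leaves one closed after,
  and it is nonempty because \<open>par i \<noteq> i\<close>.\<close>

lemma arborescence_contract:
  assumes i: "i \<notin> J" "par i \<noteq> i"
  shows "arborescence par (insert i J) \<longleftrightarrow> arborescence (\<lambda>j. if par j = i then par i else par j) J"
    (is "?L \<longleftrightarrow> ?R")
proof
  assume L: ?L
  show ?R unfolding arborescence_def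
  proof (intro allI impI)
    fix X assume X: "X \<subseteq> J" "X \<noteq> {}"
    show "\<exists>j\<in>X. (if par j = i then par i else par j) \<notin> X"
    proof (cases "par i \<in> X")
      case True
      have "insert i X \<subseteq> insert i J" "insert i X \<noteq> {}" using X by auto
      then obtain j where "j \<in> insert i X" "par j \<notin> insert i X" using L unfolding arborescence_def by blast
      then show ?thesis using True by (intro bexI[of _ j]) auto
    next
      case False
      have "X \<subseteq> insert i J" using X by auto
      then obtain j where "j \<in> X" "par j \<notin> X" using L X unfolding arborescence_def by blast
      then show ?thesis using False by auto
    qed
  qed
next
  assume R: ?R
  show ?L unfolding arborescence_def
  proof (intro allI impI)
    fix X assume X: "X \<subseteq> insert i J" "X \<noteq> {}"
    show "\<exists>j\<in>X. par j \<notin> X"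
    proof (rule ccontr)
      assume "\<not> ?thesis"
      then have c: "\<And>j. j \<in> X \<Longrightarrow> par j \<in> X" by auto
      have "X - {i} \<noteq> {}" using c X i by fastforce
      moreover have "X - {i} \<subseteq> J" using X by auto
      ultimately obtain j where "j \<in> X - {i}" "(if par j = i then par i else par j) \<notin> X - {i}"
        using R unfolding arborescence_def by blast
      then show False using c[of j] c[of i] i by (auto split: if_splits)
    qed
  qed
qed

text \<open>With \<open>N\<close> pairs of darts and \<open>l\<close> vertices besides the root,
  this number times the degree of the root will count the matchings whose last exits form an
  arborescence. It need not be an integer: for \<open>l = 0\<close> it is
  \<open>(2N - 1)!! / (2N)\<close>. It is 0 for \<open>l > N\<close> because two last exits paired
  with each other form a cycle, so the \<open>l\<close> last exits need \<open>l\<close> different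
  pairs.\<close>

definition tree_count :: "nat \<Rightarrow> nat \<Rightarrow> rat" where
  "tree_count N l = (if l \<le> N then fact (2 * N - l - 1) / (2 ^ (N - l) * fact (N - l)) else 0)"

text \<open>This is the effect of contracting one vertex. The premise excludes just
  \<open>N = l = 0\<close>, where the left side is 0 but \<open>tree_count 1 1 = 1\<close>.\<close>

lemma tree_count_Suc:
  assumes "Suc N \<noteq> Suc l \<or> N > 0"
  shows "(2 * rat_of_nat (Suc N) - rat_of_nat (Suc l) - 1) * tree_count N l = tree_count (Suc N) (Suc l)"
proof (cases "l \<le> N")
  case True
  then have "2 * N - l > 0" using assms by auto
  then obtain z where z: "2 * N - l = Suc z" using gr0_implies_Suc by blast
  have "2 * Suc N - Suc l - 1 = Suc z" "2 * N - l - 1 = z" using z by auto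
  moreover have "2 * rat_of_nat (Suc N) - rat_of_nat (Suc l) - 1 = rat_of_nat (2 * N - l)" using True by simp
  ultimately show ?thesis using True by (simp add: tree_count_def z del: of_nat_Suc)
qed (simp add: tree_count_def)

text \<open>Here \<open>v\<close> gives the vertex of a dart and \<open>e i\<close> is the last exit
  of \<open>i\<close>. Contract \<open>i\<close> into the vertex of the partner of
  \<open>e i\<close>, and let \<open>b\<close> denote degrees. Each of the \<open>b r\<close>
  partners at the root leaves a root of degree \<open>b r + b i - 2\<close>; each of the
  \<open>2N - b r - b i - card J\<close> admissible partners elsewhere leaves degree
  \<open>b r\<close>. The total \<open>b r * (2N - card J - 2)\<close> no longer contains
  \<open>b i\<close>. Contraction relabels darts, so \<open>v\<close> must be arbitrary in the
  induction.\<close>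

lemma card_arborescence_matchings:
  fixes v :: "'b \<Rightarrow> 'c" and e :: "'c \<Rightarrow> 'b"
  assumes "finite D" "card D = 2 * N" "finite J" "r \<notin> J" "v ` D \<subseteq> insert r J"
    and "\<And>i. i \<in> J \<Longrightarrow> e i \<in> D \<and> v (e i) = i" and "N > 0"
  shows "rat_of_nat (card {\<mu>\<in>matchings D. arborescence (\<lambda>i. v (\<mu> (e i))) J}) =
    rat_of_nat (card {x\<in>D. v x = r}) * tree_count N (card J)"
  using assms(3,1,2,4-)
proof (induction J arbitrary: D N v rule: finite_induct)
  case empty
  then have "{x\<in>D. v x = r} = D" by auto
  moreover have "rat_of_nat (double_fact (2 * N - 1)) = rat_of_nat (2 * N) * tree_count N 0"
  proof -
    have "rat_of_nat (double_fact (2 * N - 1)) * (2 ^ N * fact N) = fact (2 * N)"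
      using arg_cong[OF double_fact_odd[of N], of rat_of_nat] by simp
    moreover have "fact (2 * N) = rat_of_nat (2 * N) * fact (2 * N - 1)"
      using \<open>N > 0\<close> by (simp add: fact_reduce)
    ultimately show ?thesis by (simp add: tree_count_def field_simps)
  qed
  ultimately show ?case using empty by (simp add: card_matchings)
next
  case (insert i J D N v)
  note fin = \<open>finite D\<close> and cD = \<open>card D = 2 * N\<close>
  let ?b = "\<lambda>j. card {x\<in>D. v x = j}"
  have ei: "e i \<in> D" "v (e i) = i" using insert.prems by auto
  have ej: "e j \<in> D" "v (e j) = j" "e j \<noteq> e i" if "j \<in> J" for j
    using insert.prems that insert.hyps by (auto, metis insertCI)
  define c where "c t = rat_of_nat (card {\<nu>\<in>matchings (D - {e i, t}).
      arborescence (\<lambda>j. v ((\<nu> \<circ> Transposition.transpose (e i) t) (e j))) (insert i J)})" for t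
  \<comment> \<open>Such a partner closes a cycle: on \<open>{i}\<close> if \<open>t\<close> lies at
    \<open>i\<close>, on \<open>{i, j}\<close> if \<open>t\<close> is the last exit of
    \<open>j\<close>.\<close>
  have c1: "c t = 0" if t: "t \<in> D - {e i}" "v t = i \<or> t \<in> e ` J" for t
  proof -
    have "\<not> arborescence (\<lambda>j. v ((\<nu> \<circ> Transposition.transpose (e i) t) (e j))) (insert i J)"
      if \<nu>: "\<nu> \<in> matchings (D - {e i, t})" for \<nu>
    proof -
      have n: "\<nu> t = t" "\<nu> (e i) = e i" using matchingsD(5)[OF \<nu>] by auto
      show ?thesis using t(2)
      proof
        assume "v t = i"
        then show ?thesis unfolding arborescence_def using n
          by (auto intro!: exI[of _ "{i}"])
      next
        assume "t \<in> e ` J"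
        then obtain j where "j \<in> J" "t = e j" by auto
        then show ?thesis unfolding arborescence_def using n ej[of j] ei
          by (auto intro!: exI[of _ "{i, j}"])
      qed
    qed
    then have "{\<nu>\<in>matchings (D - {e i, t}).
      arborescence (\<lambda>j. v ((\<nu> \<circ> Transposition.transpose (e i) t) (e j))) (insert i J)} = {}" by blast
    then show ?thesis unfolding c_def by (simp only: card.empty of_nat_0)
  qed
  \<comment> \<open>The case \<open>J = {}\<close> is separate because no darts may remain, while
    the induction hypothesis asks for a positive number of pairs. For nonempty \<open>J\<close> some
    \<open>e j\<close> survives.\<close>
  have c2: "c t = (if J = {} then rat_of_nat (double_fact (2 * (N - 1) - 1)) else
      (if v t = r then rat_of_nat (?b r + ?b i) - 2 else rat_of_nat (?b r)) * tree_count (N - 1) (card J)) \<and>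
      (J \<noteq> {} \<longrightarrow> N > 1)"
    if t: "t \<in> D - {e i}" "v t \<noteq> i" "t \<notin> e ` J" for t
  proof -
    define v' where "v' x = (if v x = i then v t else v x)" for x
    let ?D = "D - {e i, t}"
    have cD': "card ?D = 2 * (N - 1)" using t ei fin cD by (auto simp: card_Diff_subset card_insert_if)
    have e1: "arborescence (\<lambda>j. v ((\<nu> \<circ> Transposition.transpose (e i) t) (e j))) (insert i J) \<longleftrightarrow>
         arborescence (\<lambda>j. v' (\<nu> (e j))) J"
      if \<nu>: "\<nu> \<in> matchings ?D" for \<nu>
    proof -
      have n: "\<nu> t = t" using matchingsD(5)[OF \<nu>] by auto
      have "arborescence (\<lambda>j. v ((\<nu> \<circ> Transposition.transpose (e i) t) (e j))) (insert i J) \<longleftrightarrow>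
        arborescence (\<lambda>j. v' ((\<nu> \<circ> Transposition.transpose (e i) t) (e j))) J"
        by (subst arborescence_contract) (use insert.hyps t n in \<open>auto simp: v'_def cong: if_cong\<close>)
      also have "\<dots> \<longleftrightarrow> arborescence (\<lambda>j. v' (\<nu> (e j))) J"
        by (rule arborescence_cong) (use t ej in \<open>auto simp: Transposition.transpose_def\<close>)
      finally show ?thesis .
    qed
    have ct: "c t = rat_of_nat (card {\<nu>\<in>matchings ?D. arborescence (\<lambda>j. v' (\<nu> (e j))) J})"
      unfolding c_def by (rule arg_cong[where f = "\<lambda>x. rat_of_nat (card x)"]) (use e1 in auto)
    show ?thesis
    proof (cases "J = {}")
      case True
      then show ?thesis using ct cD' fin by (simp add: card_matchings)
    next
      case False
      then obtain j where j: "j \<in> J" by auto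
      then have "e j \<in> ?D" using t ej by auto
      then have "card ?D > 0" using fin by (auto simp: card_gt_0_iff)
      then have N: "N > 1" using cD' by auto
      have "c t = rat_of_nat (card {x\<in>?D. v' x = r}) * tree_count (N - 1) (card J)"
        unfolding ct
      proof (rule insert.IH)
        show "v' ` ?D \<subseteq> insert r J"
          using insert.prems t unfolding v'_def by auto
        fix j assume "j \<in> J"
        then show "e j \<in> ?D \<and> v' (e j) = j" using t ej[of j] insert.hyps by (auto simp: v'_def)
      qed (use cD' fin N insert.prems in auto)
      moreover have "rat_of_nat (card {x\<in>?D. v' x = r}) = (if v t = r then rat_of_nat (?b r + ?b i) - 2 else rat_of_nat (?b r))"
      proof (cases "v t = r")
        case True
        have "{x\<in>?D. v' x = r} = ({x\<in>D. v x = r} - {t}) \<union> ({x\<in>D. v x = i} - {e i})"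
          using True insert.prems t ei by (auto simp: v'_def)
        moreover have "card \<dots> = card ({x\<in>D. v x = r} - {t}) + card ({x\<in>D. v x = i} - {e i})"
          by (rule card_Un_disjoint) (use fin insert.prems in auto)
        moreover have "card ({x\<in>D. v x = r} - {t}) = ?b r - 1" "card ({x\<in>D. v x = i} - {e i}) = ?b i - 1"
          using True t ei by (auto simp: card_Diff_singleton)
        moreover have "?b r > 0" "?b i > 0" using True t ei fin by (auto simp: card_gt_0_iff)
        ultimately show ?thesis using True by simp
      next
        case False
        then have "{x\<in>?D. v' x = r} = {x\<in>D. v x = r}" using insert.prems ei by (auto simp: v'_def)
        then show ?thesis using False by simp
      qed
      ultimately show ?thesis using False N by simp
    qed
  qed
  have "rat_of_nat (card {\<mu>\<in>matchings D. arborescence (\<lambda>i. v (\<mu> (e i))) (insert i J)}) = (\<Sum>t\<in>D - {e i}. c t)"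
    unfolding c_def by (subst card_matchings_split[OF fin ei(1)]) simp
  also have "\<dots> = (\<Sum>t\<in>{t\<in>D. v t \<noteq> i \<and> t \<notin> e ` J}. c t)"
    by (rule sum.mono_neutral_right) (use fin c1 ei in auto)
  also have "{t\<in>D. v t \<noteq> i \<and> t \<notin> e ` J} = {t\<in>D. v t = r} \<union> {t\<in>D. v t \<in> J \<and> t \<notin> e ` J}"
    using insert.prems insert.hyps ej by auto
  also have "(\<Sum>t\<in>\<dots>. c t) = (\<Sum>t\<in>{t\<in>D. v t = r}. c t) + (\<Sum>t\<in>{t\<in>D. v t \<in> J \<and> t \<notin> e ` J}. c t)"
    by (rule sum.union_disjoint) (use fin insert.prems in auto)
  also have "\<dots> = rat_of_nat (?b r) * tree_count N (card (insert i J))"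
  proof -
    have tr: "t \<in> D - {e i}" "v t \<noteq> i" "t \<notin> e ` J" if "t \<in> {t\<in>D. v t = r}" for t
      using that insert.prems ei ej by auto
    have tj: "t \<in> D - {e i}" "v t \<noteq> i" "t \<notin> e ` J" "v t \<noteq> r"
      if "t \<in> {t\<in>D. v t \<in> J \<and> t \<notin> e ` J}" for t
      using that insert.prems insert.hyps ei by auto
    show ?thesis
    proof (cases "J = {}")
      case True
      have "(\<Sum>t\<in>{t\<in>D. v t = r}. c t) = (\<Sum>t\<in>{t\<in>D. v t = r}. rat_of_nat (double_fact (2 * (N - 1) - 1)))"
        by (rule sum.cong) (use c2[OF tr] True in auto)
      moreover have "rat_of_nat (double_fact (2 * (N - 1) - 1)) = tree_count N 1"
        using arg_cong[OF double_fact_odd[of "N - 1"], of rat_of_nat] insert.prems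
        by (simp add: tree_count_def field_simps diff_mult_distrib2)
      ultimately show ?thesis using True by simp
    next
      case False
      have "(\<Sum>t\<in>{t\<in>D. v t = r}. c t) = (\<Sum>t\<in>{t\<in>D. v t = r}. (rat_of_nat (?b r + ?b i) - 2) * tree_count (N - 1) (card J))"
        by (rule sum.cong) (use c2[OF tr(1-3)] False in auto)
      moreover have "(\<Sum>t\<in>{t\<in>D. v t \<in> J \<and> t \<notin> e ` J}. c t) = (\<Sum>t\<in>{t\<in>D. v t \<in> J \<and> t \<notin> e ` J}. rat_of_nat (?b r) * tree_count (N - 1) (card J))"
        by (rule sum.cong) (use c2[OF tj(1-3)] tj(4) False in auto)
      moreover have "rat_of_nat (card {t\<in>D. v t \<in> J \<and> t \<notin> e ` J}) = 2 * rat_of_nat N - rat_of_nat (?b r) - rat_of_nat (?b i) - rat_of_nat (card J)"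
      proof -
        have "D = {t\<in>D. v t \<in> J \<and> t \<notin> e ` J} \<union> e ` J \<union> {t\<in>D. v t = r} \<union> {t\<in>D. v t = i}"
          using insert.prems ej by auto
        moreover have "card \<dots> = card {t\<in>D. v t \<in> J \<and> t \<notin> e ` J} + card (e ` J) + ?b r + ?b i"
          using fin insert.hyps insert.prems ej by (subst card_Un_disjoint; auto)+
        moreover have "card (e ` J) = card J" by (rule card_image) (metis ej(2) inj_onI)
        ultimately show ?thesis using cD by simp
      qed
      moreover obtain M where M: "N = Suc M" using insert.prems by (cases N) auto
      ultimately have eq: "(\<Sum>t\<in>{t\<in>D. v t = r}. c t) + (\<Sum>t\<in>{t\<in>D. v t \<in> J \<and> t \<notin> e ` J}. c t) =
          rat_of_nat (?b r) * ((2 * rat_of_nat (Suc M) - rat_of_nat (Suc (card J)) - 1) * tree_count M (card J))"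
        by (simp add: algebra_simps)
      show ?thesis
      proof (cases "?b r = 0")
        case True
        then show ?thesis using eq by simp
      next
        case b: False
        obtain j where "j \<in> J" using False by auto
        have "M > 0"
        proof (rule ccontr)
          assume "\<not> M > 0"
          have "{e i, e j} \<subseteq> D" "card {e i, e j} = 2" using ei ej[OF \<open>j \<in> J\<close>] by auto
          then have "{e i, e j} = D" using cD M \<open>\<not> M > 0\<close> fin by (intro card_subset_eq) auto
          then have "{x\<in>D. v x = r} = {}" using insert.prems ei ej[OF \<open>j \<in> J\<close>] \<open>j \<in> J\<close> by auto
          then show False using b by (simp only: card.empty)
        qed
        then show ?thesis using eq tree_count_Suc[of M "card J"] insert.hyps M by simp
      qed
    qed
  qed
  finally show ?case .
qed

section \<open>Closed words following prescribed exits\<close>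

text \<open>The bijection is conjugation by \<open>s\<close>, extended by the identity.
  \<open>P\<close> and \<open>Q\<close> are compared only on matchings that \<open>s\<close>
  intertwines, so applications never unfold the transported matching.\<close>

lemma card_matchings_transfer:
  assumes s: "bij_betw s S D"
    and PQ: "\<And>\<pi> \<mu>. \<pi> \<in> matchings S \<Longrightarrow> \<mu> \<in> matchings D \<Longrightarrow> (\<And>x. x \<in> S \<Longrightarrow> s (\<pi> x) = \<mu> (s x)) \<Longrightarrow> P \<pi> \<longleftrightarrow> Q \<mu>"
  shows "card {\<pi>\<in>matchings S. P \<pi>} = card {\<mu>\<in>matchings D. Q \<mu>}"
proof -
  define u where "u = inv_into S s"
  have u: "\<And>y. y \<in> D \<Longrightarrow> u y \<in> S" "\<And>y. y \<in> D \<Longrightarrow> s (u y) = y" "\<And>x. x \<in> S \<Longrightarrow> u (s x) = x"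
    "\<And>x. x \<in> S \<Longrightarrow> s x \<in> D"
    using s unfolding u_def bij_betw_def by (auto simp: inv_into_into f_inv_into_f)
  define F where "F \<pi> y = (if y \<in> D then s (\<pi> (u y)) else y)" for \<pi> y
  define G where "G \<mu> x = (if x \<in> S then u (\<mu> (s x)) else x)" for \<mu> x
  have F: "F \<pi> \<in> matchings D" if "\<pi> \<in> matchings S" for \<pi>
    using matchingsD[OF that] u by (intro matchingsI) (auto simp: F_def, metis)
  have G: "G \<mu> \<in> matchings S" if "\<mu> \<in> matchings D" for \<mu>
    using matchingsD[OF that] u by (intro matchingsI) (auto simp: G_def, metis)
  have GF: "G (F \<pi>) = \<pi>" if "\<pi> \<in> matchings S" for \<pi>
    using matchingsD[OF that] u by (auto simp: F_def G_def fun_eq_iff)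
  have FG: "F (G \<mu>) = \<mu>" if "\<mu> \<in> matchings D" for \<mu>
    using matchingsD[OF that] u by (auto simp: F_def G_def fun_eq_iff)
  have PF: "P \<pi> \<longleftrightarrow> Q (F \<pi>)" if "\<pi> \<in> matchings S" for \<pi>
    using that u by (intro PQ F) (auto simp: F_def)
  have PG: "P (G \<mu>) \<longleftrightarrow> Q \<mu>" if "\<mu> \<in> matchings D" for \<mu>
    using PF[OF G[OF that]] FG[OF that] by simp
  have "bij_betw F {\<pi>\<in>matchings S. P \<pi>} {\<mu>\<in>matchings D. Q \<mu>}"
    by (rule bij_betw_byWitness[where f' = G]) (use F G GF FG PF PG in auto)
  then show ?thesis by (rule bij_betw_same_card)
qed

text \<open>The \<open>j\<close>-th letter of \<open>w\<close>, made distinct from its equals by the number of its earlier occurrences.\<close>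

definition dart :: "'c list \<Rightarrow> nat \<Rightarrow> 'c \<times> nat" where
  "dart w j = (w ! j, count_list (take j w) (w ! j))"

definition darts :: "'c set \<Rightarrow> ('c \<Rightarrow> nat) \<Rightarrow> ('c \<times> nat) set" where
  "darts I \<gamma> = (SIGMA i:I. {..<\<gamma> i})"

definition words :: "'c set \<Rightarrow> ('c \<Rightarrow> nat) \<Rightarrow> 'c list set" where
  "words I \<gamma> = {w. set w \<subseteq> I \<and> (\<forall>i\<in>I. count_list w i = \<gamma> i)}"

text \<open>A rotor rule: visit number \<open>c\<close> to the letter \<open>i\<close>, counted from
  0, leaves through the dart \<open>(i, c)\<close>, and \<open>h\<close> tells which letter comes
  next. The last exit of \<open>i\<close> is therefore \<open>(i, \<gamma> i - 1)\<close>. The index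
  modulo the length closes the walk.\<close>

definition tours :: "'c set \<Rightarrow> ('c \<Rightarrow> nat) \<Rightarrow> 'c \<Rightarrow> ('c \<times> nat \<Rightarrow> 'c) \<Rightarrow> 'c list set" where
  "tours I \<gamma> r h = {w\<in>words I \<gamma>. w ! 0 = r \<and> (\<forall>j<length w. h (dart w j) = w ! (Suc j mod length w))}"

lemma finite_darts: "finite I \<Longrightarrow> finite (darts I \<gamma>)"
  by (simp add: darts_def)

lemma card_darts: "finite I \<Longrightarrow> card (darts I \<gamma>) = sum \<gamma> I"
  by (simp add: darts_def)

lemma dart_append: "j < length w \<Longrightarrow> dart (w @ w') j = dart w j"
  by (simp add: dart_def nth_append)

lemma dart_image: "dart w ` {..<length w} = darts (set w) (count_list w)"
proof (induction w rule: rev_induct)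
  case (snoc x w)
  have "dart (w @ [x]) ` {..<length (w @ [x])} =
      insert (dart (w @ [x]) (length w)) (dart (w @ [x]) ` {..<length w})"
    by (simp add: lessThan_Suc)
  also have "dart (w @ [x]) (length w) = (x, count_list w x)" by (simp add: dart_def)
  also have "dart (w @ [x]) ` {..<length w} = dart w ` {..<length w}"
    by (rule image_cong) (auto simp: dart_append)
  also have "insert (x, count_list w x) (dart w ` {..<length w}) = insert (x, count_list w x) (darts (set w) (count_list w))"
    by (simp only: snoc.IH)
  also have "\<dots> = darts (set (w @ [x])) (count_list (w @ [x]))"
    by (auto simp: darts_def less_Suc_eq split: if_splits)
  finally show ?case .
qed (simp add: darts_def)

text \<open>By counting: the image has as many elements as all letter multiplicities together, which
  is the length of the word.\<close>

lemma inj_on_dart: "inj_on (dart w) {..<length w}"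
proof (rule eq_card_imp_inj_on)
  show "card (dart w ` {..<length w}) = card {..<length w}"
    unfolding dart_image by (simp add: card_darts sum_count_set)
qed simp

lemma count_list_take_mono: "j \<le> j' \<Longrightarrow> count_list (take j w) x \<le> count_list (take j' w) x"
  by (metis count_list_append le_add1 le_add_diff_inverse take_add)

lemma length_words:
  assumes "finite I" "w \<in> words I \<gamma>"
  shows "length w = sum \<gamma> I"
proof -
  have "length w = sum (count_list w) I" using assms by (intro sum_count_set[symmetric]) (auto simp: words_def)
  also have "\<dots> = sum \<gamma> I" using assms by (intro sum.cong) (auto simp: words_def)
  finally show ?thesis .
qed

lemma set_words:
  assumes "\<And>i. i \<in> I \<Longrightarrow> \<gamma> i > 0" "w \<in> words I \<gamma>"
  shows "set w = I"
proof -
  have "i \<in> set w" if "i \<in> I" for i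
    using assms that count_list_0_iff[of w i] by (force simp: words_def)
  then show ?thesis using assms(2) by (auto simp: words_def)
qed

lemma finite_words: "finite I \<Longrightarrow> finite (words I \<gamma>)"
  by (rule finite_subset[OF _ finite_lists_length_eq[of I "sum \<gamma> I"]])
    (auto simp: length_words, auto simp: words_def)

lemma dart_words:
  assumes "\<And>i. i \<in> I \<Longrightarrow> \<gamma> i > 0" "w \<in> words I \<gamma>"
  shows "bij_betw (dart w) {..<length w} (darts I \<gamma>)"
  using inj_on_dart[of w] dart_image[of w] set_words[OF assms] assms(2)
  by (auto simp: bij_betw_def darts_def words_def)

lemma count_list_map_card: "count_list (map f [0..<n]) y = card {j. j < n \<and> f j = y}"
  by (simp add: count_list_eq_length_filter length_filter_conv_card eq_commute[of y] cong: conj_cong)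

text \<open>Determinism: the prefix through position \<open>i\<close> fixes the dart used there, and
  \<open>h\<close> then fixes the next letter.\<close>

lemma tours_unique:
  assumes "finite I" "w \<in> tours I \<gamma> r h" "w' \<in> tours I \<gamma> r h"
  shows "w = w'"
proof (rule nth_equalityI)
  show len: "length w = length w'" using assms length_words[of I _ \<gamma>] by (auto simp: tours_def)
  fix j assume "j < length w"
  then show "w ! j = w' ! j"
  proof (induction j rule: less_induct)
    case (less j)
    show ?case
    proof (cases j)
      case (Suc i)
      have "take (Suc i) w = take (Suc i) w'"
        by (rule nth_take_lemma) (use Suc less len in auto)
      then have "take i w = take i w'" by (metis Suc_n_not_le_n nat_le_linear take_all_iff min.absorb1 take_take)
      then have "dart w i = dart w' i" using less Suc by (simp add: dart_def)
      then show ?thesis using assms less.prems Suc len by (auto simp: tours_def dest!: spec[of _ i])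
    qed (use assms in \<open>auto simp: tours_def\<close>)
  qed
qed

text \<open>Among the last exits of the vertices in \<open>X\<close>, the one used latest must leave
  \<open>X\<close>: a vertex of \<open>X\<close> entered by it would still have to be left, so its
  own last exit would come later.\<close>

lemma tours_imp_arborescence:
  assumes pos: "\<And>i. i \<in> I \<Longrightarrow> \<gamma> i > 0" and w: "w \<in> tours I \<gamma> r h"
  shows "arborescence (\<lambda>i. h (i, \<gamma> i - 1)) (I - {r})"
  unfolding arborescence_def
proof (intro allI impI)
  fix X assume X: "X \<subseteq> I - {r}" "X \<noteq> {}"
  have ww: "w \<in> words I \<gamma>" using w by (simp add: tours_def)
  have im: "dart w ` {..<length w} = darts I \<gamma>" using dart_words[OF pos ww] by (simp add: bij_betw_def)
  have ex: "\<exists>j<length w. dart w j = (i, \<gamma> i - 1)" if "i \<in> X" for i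
  proof -
    have "(i, \<gamma> i - 1) \<in> darts I \<gamma>" using that X pos[of i] by (auto simp: darts_def)
    then show ?thesis unfolding im[symmetric] by fastforce
  qed
  define S where "S = {j. j < length w \<and> (\<exists>i\<in>X. dart w j = (i, \<gamma> i - 1))}"
  have S: "finite S" "S \<noteq> {}" unfolding S_def using X ex by auto
  define j where "j = Max S"
  have "j \<in> S" unfolding j_def using S by (rule Max_in)
  then obtain i where i: "i \<in> X" "j < length w" "dart w j = (i, \<gamma> i - 1)" by (auto simp: S_def)
  have h: "h (i, \<gamma> i - 1) = w ! (Suc j mod length w)" using w i by (auto simp: tours_def)
  show "\<exists>i\<in>X. h (i, \<gamma> i - 1) \<notin> X"
  proof (rule bexI[OF _ i(1)], rule notI)
    assume hX: "h (i, \<gamma> i - 1) \<in> X"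
    define x where "x = w ! (Suc j mod length w)"
    have x: "x \<in> X" using hX h by (simp add: x_def)
    \<comment> \<open>Position 0 carries \<open>r\<close>, which is not in \<open>X\<close>, so the
      step into \<open>x\<close> does not wrap around.\<close>
    have "Suc j \<noteq> length w" using x X w by (auto simp: x_def tours_def)
    then have sj: "Suc j < length w" using i by simp
    then have xw: "w ! Suc j = x" by (simp add: x_def)
    have "dart w (Suc j) \<in> darts I \<gamma>" using im sj by blast
    then have lt: "count_list (take (Suc j) w) x < \<gamma> x" by (simp add: dart_def darts_def xw)
    obtain j' where j': "j' < length w" "dart w j' = (x, \<gamma> x - 1)" using ex[OF x] by auto
    then have "j' \<le> j" unfolding j_def using S x by (intro Max_ge) (auto simp: S_def)
    then have "count_list (take (Suc j') w) x \<le> count_list (take (Suc j) w) x"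
      by (intro count_list_take_mono) simp
    moreover have "count_list (take (Suc j') w) x = \<gamma> x"
      using j' pos[of x] x X by (auto simp: dart_def take_Suc_conv_app_nth)
    ultimately show False using lt by simp
  qed
qed

text \<open>
  A longest trail that follows \<open>h\<close> can only get stuck at \<open>r\<close>; the vertices with unused darts would then
  be closed under passing to the parent.
\<close>

lemma arborescence_imp_tours:
  assumes fin: "finite I" and pos: "\<And>i. i \<in> I \<Longrightarrow> \<gamma> i > 0" and r: "r \<in> I"
    and hI: "\<And>d. d \<in> darts I \<gamma> \<Longrightarrow> h d \<in> I"
    and bal: "\<And>i. i \<in> I \<Longrightarrow> card {d\<in>darts I \<gamma>. h d = i} = \<gamma> i"
    and arb: "arborescence (\<lambda>i. h (i, \<gamma> i - 1)) (I - {r})"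
  shows "tours I \<gamma> r h \<noteq> {}"
proof -
  \<comment> \<open>Trails that follow \<open>h\<close> at every inner step and exceed no
    multiplicity, but need not be closed or exhaust the darts.\<close>
  define T where "T = {w. w \<noteq> [] \<and> w ! 0 = r \<and> set w \<subseteq> I \<and> (\<forall>i\<in>I. count_list w i \<le> \<gamma> i) \<and>
    (\<forall>j. Suc j < length w \<longrightarrow> h (dart w j) = w ! Suc j)}"
  have "[r] \<in> T" using r pos by (auto simp: T_def Suc_leI)
  moreover have "length w \<le> sum \<gamma> I" if "w \<in> T" for w
  proof -
    have "length w = (\<Sum>i\<in>I. count_list w i)" using that fin by (simp add: T_def sum_count_set)
    also have "\<dots> \<le> sum \<gamma> I" using that by (intro sum_mono) (auto simp: T_def)
    finally show ?thesis .
  qed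
  ultimately obtain w where w: "w \<in> T" "\<And>w'. w' \<in> T \<Longrightarrow> length w' \<le> length w"
    using ex_has_greatest_nat[of "\<lambda>w. w \<in> T" "[r]" length "Suc (sum \<gamma> I)"] by (auto simp: less_Suc_eq_le)
  define n where "n = length w"
  have n: "n > 0" using w by (auto simp: T_def n_def)
  have sub: "darts (set w) (count_list w) \<subseteq> darts I \<gamma>"
    using w(1) by (auto simp: T_def darts_def intro: less_le_trans)
  define x where "x = h (dart w (n - 1))"
  have "dart w (n - 1) \<in> darts I \<gamma>" using sub dart_image[of w] n by (auto simp: n_def)
  then have xI: "x \<in> I" using hI by (simp add: x_def)
  have xfull: "count_list w x = \<gamma> x"
  proof (rule ccontr)
    assume "count_list w x \<noteq> \<gamma> x"
    then have "w @ [x] \<in> T"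
      using w(1) xI unfolding T_def
      by (auto simp: nth_append dart_append n_def x_def le_neq_implies_less Suc_leI less_Suc_eq dest!: sym[of "Suc _" "length w"])
    then show False using w(2)[of "w @ [x]"] by simp
  qed
  have hw: "map (h \<circ> dart w) [0..<n] = tl w @ [x]"
  proof (rule nth_equalityI)
    show "length (map (h \<circ> dart w) [0..<n]) = length (tl w @ [x])" using n by (simp add: n_def)
    fix j assume "j < length (map (h \<circ> dart w) [0..<n])"
    then have j: "j < n" by simp
    show "map (h \<circ> dart w) [0..<n] ! j = (tl w @ [x]) ! j"
    proof (cases "Suc j < n")
      case True
      then show ?thesis using w(1) by (auto simp: nth_append nth_tl n_def T_def)
    next
      case False
      then have "j = n - 1" using j by simp
      then show ?thesis using n by (simp add: nth_append n_def x_def)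
    qed
  qed
  \<comment> \<open>The left side counts entries into \<open>y\<close>, including the pending step
    to \<open>x\<close>; the right side counts used darts that lead to \<open>y\<close>. Balance of
    \<open>h\<close> thus bounds the entries by \<open>\<gamma> y\<close>.\<close>
  have hcard: "count_list (tl w @ [x]) y = card {d\<in>darts (set w) (count_list w). h d = y}" for y
  proof -
    have "count_list (tl w @ [x]) y = card {j. j < n \<and> (h \<circ> dart w) j = y}"
      unfolding hw[symmetric] by (rule count_list_map_card)
    also have "\<dots> = card (dart w ` {j. j < n \<and> (h \<circ> dart w) j = y})"
      by (rule card_image[symmetric], rule inj_on_subset[OF inj_on_dart[of w]]) (auto simp: n_def)
    also have "dart w ` {j. j < n \<and> (h \<circ> dart w) j = y} = {d\<in>darts (set w) (count_list w). h d = y}"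
      unfolding dart_image[symmetric] by (auto simp: n_def)
    finally show ?thesis .
  qed
  have finD: "finite (darts I \<gamma>)" using fin by (rule finite_darts)
  have hle: "count_list (tl w @ [x]) y \<le> \<gamma> y" if "y \<in> I" for y
    unfolding hcard bal[OF that, symmetric] by (rule card_mono) (use sub finD in auto)
  have w0: "w = r # tl w" using w(1) by (cases w) (auto simp: T_def)
  \<comment> \<open>At any other vertex the entries outnumber the exits by one, and all
    \<open>\<gamma> x\<close> exits are already used.\<close>
  have "x = r"
  proof (rule ccontr)
    assume "x \<noteq> r"
    then have "count_list (tl w @ [x]) x = Suc (count_list w x)" by (subst (2) w0) simp
    then show False using hle[OF xI] xfull by simp
  qed
  have cw: "count_list (tl w @ [x]) y = count_list w y" for y
    unfolding \<open>x = r\<close> by (subst (2) w0) simp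
  have all: "count_list w i = \<gamma> i" if "i \<in> I" for i
  proof (rule ccontr)
    define X where "X = {i\<in>I. count_list w i \<noteq> \<gamma> i}"
    assume "count_list w i \<noteq> \<gamma> i"
    then have "X \<subseteq> I - {r}" "X \<noteq> {}" using that xfull \<open>x = r\<close> by (auto simp: X_def)
    then obtain i where i: "i \<in> X" "h (i, \<gamma> i - 1) \<notin> X" using arb unfolding arborescence_def by blast
    then have d: "(i, \<gamma> i - 1) \<in> darts I \<gamma>" using pos[of i] by (auto simp: X_def darts_def)
    define y where "y = h (i, \<gamma> i - 1)"
    have y: "y \<in> I" "count_list w y = \<gamma> y" using hI[OF d] i by (auto simp: X_def y_def)
    have "{d\<in>darts (set w) (count_list w). h d = y} = {d\<in>darts I \<gamma>. h d = y}"
      by (rule card_subset_eq) (use sub finD y hcard[of y] cw[of y] bal[of y] in auto)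
    then have "(i, \<gamma> i - 1) \<in> darts (set w) (count_list w)" using d by (auto simp: y_def)
    then have "\<gamma> i - 1 < count_list w i" by (auto simp: darts_def)
    moreover have "count_list w i < \<gamma> i" using i w(1) by (auto simp: X_def T_def le_neq_implies_less)
    ultimately show False by simp
  qed
  have "w \<in> tours I \<gamma> r h"
    unfolding tours_def words_def
  proof (safe)
    show "w ! 0 = r" using w(1) by (simp add: T_def)
    fix j assume j: "j < length w"
    show "h (dart w j) = w ! (Suc j mod length w)"
    proof (cases "Suc j = length w")
      case True
      then have "h (dart w j) = x" by (simp add: x_def n_def flip: True)
      then show ?thesis using True \<open>x = r\<close> w(1) by (simp add: T_def)
    next
      case False
      then show ?thesis using j w(1) by (auto simp: T_def)
    qed
  qed (use w(1) all in \<open>auto simp: T_def\<close>)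
  then show ?thesis by auto
qed

lemma card_tours:
  assumes "finite I" "\<And>i. i \<in> I \<Longrightarrow> \<gamma> i > 0" "r \<in> I"
    and "\<And>d. d \<in> darts I \<gamma> \<Longrightarrow> h d \<in> I"
    and "\<And>i. i \<in> I \<Longrightarrow> card {d\<in>darts I \<gamma>. h d = i} = \<gamma> i"
  shows "card (tours I \<gamma> r h) = of_bool (arborescence (\<lambda>i. h (i, \<gamma> i - 1)) (I - {r}))"
proof (cases "tours I \<gamma> r h = {}")
  case True
  then show ?thesis using arborescence_imp_tours[OF assms] by auto
next
  case False
  then obtain w where w: "w \<in> tours I \<gamma> r h" by auto
  then have "tours I \<gamma> r h = {w}" using tours_unique[OF assms(1)] by auto
  then show ?thesis using tours_imp_arborescence[OF assms(2) w] by simp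
qed

text \<open>Numbering positions by their darts turns \<open>\<pi>\<close> into a matching
  \<open>\<mu>\<close> of darts, and the condition says that \<open>w\<close> is a tour for
  \<open>fst \<circ> \<mu>\<close>. Each \<open>\<mu>\<close> has at most one tour from a given
  \<open>r\<close>, so the sum over words starting with \<open>r\<close> counts the
  \<open>\<mu>\<close> that satisfy the arborescence condition.\<close>

lemma card_word_matchings:
  assumes fin: "finite I" and pos: "\<And>i. i \<in> I \<Longrightarrow> \<gamma> i > 0" and N: "N > 0" "sum \<gamma> I = 2 * N"
  shows "rat_of_nat (card (SIGMA w:words I \<gamma>. {\<pi>\<in>matchings {..<2 * N}. \<forall>j<2 * N. w ! \<pi> j = w ! (Suc j mod (2 * N))})) =
    2 * rat_of_nat N * tree_count N (card I - 1)"
proof -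
  define M where "M w = {\<pi>\<in>matchings {..<2 * N}. \<forall>j<2 * N. w ! \<pi> j = w ! (Suc j mod (2 * N))}" for w :: "'a list"
  let ?D = "darts I \<gamma>"
  have len: "length w = 2 * N" if "w \<in> words I \<gamma>" for w
    using length_words[OF fin that] N by simp
  have fM: "finite (M w)" for w unfolding M_def by (simp add: finite_matchings)
  have fD: "finite ?D" "card ?D = 2 * N" using fin N by (auto simp: finite_darts card_darts)
  have cM: "card (M w) = card {\<mu>\<in>matchings ?D. w \<in> tours I \<gamma> r (fst \<circ> \<mu>)}"
    if w: "w \<in> words I \<gamma>" "w ! 0 = r" for w r
    unfolding M_def
  proof (rule card_matchings_transfer)
    show "bij_betw (dart w) {..<2 * N} ?D" using dart_words[OF pos w(1)] len[OF w(1)] by simp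
    fix \<pi> \<mu> assume *: "\<And>x. x \<in> {..<2 * N} \<Longrightarrow> dart w (\<pi> x) = \<mu> (dart w x)"
    have "fst (\<mu> (dart w x)) = w ! \<pi> x" if "x < 2 * N" for x
      using *[of x] that by (simp add: dart_def prod_eq_iff)
    then show "(\<forall>j<2 * N. w ! \<pi> j = w ! (Suc j mod (2 * N))) \<longleftrightarrow> w \<in> tours I \<gamma> r (fst \<circ> \<mu>)"
      using w len[OF w(1)] by (auto simp: tours_def)
  qed
  have cr: "rat_of_nat (\<Sum>w\<in>{w\<in>words I \<gamma>. w ! 0 = r}. card (M w)) = rat_of_nat (\<gamma> r) * tree_count N (card I - 1)"
    if r: "r \<in> I" for r
  proof -
    \<comment> \<open>The involution exchanges the darts leading to \<open>i\<close> with the darts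
      at \<open>i\<close>, which gives the balance that closed walks need.\<close>
    have bal: "card {d\<in>?D. (fst \<circ> \<mu>) d = i} = \<gamma> i" if "\<mu> \<in> matchings ?D" "i \<in> I" for \<mu> i
    proof -
      note m = matchingsD[OF that(1)]
      have "bij_betw \<mu> {d\<in>?D. (fst \<circ> \<mu>) d = i} {d\<in>?D. fst d = i}"
        by (rule bij_betw_byWitness[where f' = \<mu>]) (use m in auto)
      then have "card {d\<in>?D. (fst \<circ> \<mu>) d = i} = card {d\<in>?D. fst d = i}" by (rule bij_betw_same_card)
      also have "{d\<in>?D. fst d = i} = Pair i ` {..<\<gamma> i}" using that by (auto simp: darts_def)
      also have "card \<dots> = \<gamma> i" by (simp add: card_image inj_on_def)
      finally show ?thesis .
    qed
    have "(\<Sum>w\<in>{w\<in>words I \<gamma>. w ! 0 = r}. card (M w)) =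
      (\<Sum>w\<in>{w\<in>words I \<gamma>. w ! 0 = r}. card {\<mu>\<in>matchings ?D. w \<in> tours I \<gamma> r (fst \<circ> \<mu>)})"
      by (rule sum.cong) (auto simp: cM)
    also have "\<dots> = (\<Sum>\<mu>\<in>matchings ?D. card {w\<in>{w\<in>words I \<gamma>. w ! 0 = r}. w \<in> tours I \<gamma> r (fst \<circ> \<mu>)})"
      by (rule sum_multicount_gen) (use fin fD in \<open>auto simp: finite_words finite_matchings\<close>)
    also have "\<dots> = (\<Sum>\<mu>\<in>matchings ?D. card (tours I \<gamma> r (fst \<circ> \<mu>)))"
      by (intro sum.cong refl arg_cong[where f = card]) (auto simp: tours_def)
    also have "\<dots> = (\<Sum>\<mu>\<in>matchings ?D. of_bool (arborescence (\<lambda>i. fst (\<mu> (i, \<gamma> i - 1))) (I - {r})))"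
    proof (rule sum.cong[OF refl])
      fix \<mu> assume \<mu>: "\<mu> \<in> matchings ?D"
      have "(fst \<circ> \<mu>) d \<in> I" if "d \<in> ?D" for d using matchingsD(2)[OF \<mu> that] by (auto simp: darts_def)
      then show "card (tours I \<gamma> r (fst \<circ> \<mu>)) = of_bool (arborescence (\<lambda>i. fst (\<mu> (i, \<gamma> i - 1))) (I - {r}))"
        by (subst card_tours[OF fin pos r _ bal[OF \<mu>]]) auto
    qed
    also have "\<dots> = card {\<mu>\<in>matchings ?D. arborescence (\<lambda>i. fst (\<mu> (i, \<gamma> i - 1))) (I - {r})}"
      using fD by (simp add: finite_matchings of_bool_def sum.If_cases Int_def)
    also have "rat_of_nat \<dots> = rat_of_nat (card {d\<in>?D. fst d = r}) * tree_count N (card (I - {r}))"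
      by (rule card_arborescence_matchings) (use fin fD N pos r in \<open>auto simp: darts_def\<close>)
    also have "{d\<in>?D. fst d = r} = Pair r ` {..<\<gamma> r}" using r by (auto simp: darts_def)
    also have "card \<dots> = \<gamma> r" by (simp add: card_image inj_on_def)
    finally show ?thesis using r by simp
  qed
  have "card (SIGMA w:words I \<gamma>. M w) = (\<Sum>w\<in>words I \<gamma>. card (M w))"
    using fin fM by (simp add: finite_words)
  also have "\<dots> = (\<Sum>r\<in>I. \<Sum>w\<in>{w\<in>words I \<gamma>. w ! 0 = r}. card (M w))"
  proof (rule sum.group[symmetric])
    show "(\<lambda>w. w ! 0) ` words I \<gamma> \<subseteq> I"
    proof safe
      fix w assume w: "w \<in> words I \<gamma>"
      have "w ! 0 \<in> set w" using len[OF w] N by (intro nth_mem) simp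
      then show "w ! 0 \<in> I" using w by (auto simp: words_def)
    qed
  qed (use fin finite_words in auto)
  also have "rat_of_nat \<dots> = (\<Sum>r\<in>I. rat_of_nat (\<gamma> r) * tree_count N (card I - 1))"
    unfolding of_nat_sum using cr by (intro sum.cong) auto
  also have "\<dots> = rat_of_nat (sum \<gamma> I) * tree_count N (card I - 1)"
    by (simp add: sum_distrib_right)
  finally show ?thesis unfolding M_def N by simp
qed

section \<open>Colourings of a given type\<close>

lemma fpf_involutions_eq: "fpf_involutions N = matchings (points N)"
  by (simp add: fpf_involutions_def matchings_def)

lemma std_cycle_permutes: "std_cycle N permutes points N"
proof -
  have "set [1..<2 * N + 1] = points N" by auto
  then show ?thesis unfolding std_cycle_def by (metis cycle_permutes)
qed

lemma std_cycle_apply: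
  assumes "j < 2 * N"
  shows "std_cycle N (Suc j) = Suc (Suc j mod (2 * N))"
proof -
  let ?cs = "[1..<2 * N + 1]"
  have "map (std_cycle N) ?cs = rotate1 ?cs"
    using cyclic_rotation[of ?cs 1] by (simp add: std_cycle_def)
  then have "std_cycle N (?cs ! j) = rotate1 ?cs ! j"
    using assms by (metis length_upt nth_map diff_add_inverse2)
  also have "\<dots> = ?cs ! (Suc j mod (2 * N))"
    using assms by (subst nth_rotate1) auto
  finally have "std_cycle N (?cs ! j) = ?cs ! (Suc j mod (2 * N))" .
  moreover have "?cs ! i = Suc i" if "i < 2 * N" for i using that by (subst nth_upt) auto
  ultimately show ?thesis using assms by simp
qed

text \<open>
  Reading a colouring backwards from \<open>2N\<close> turns \<open>f (\<pi> (x + 1)) = f x\<close> into the relation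
  \<open>w ! \<pi> j = w ! (j + 1)\<close> between the letters of a word.
\<close>

lemma card_colouring_matchings:
  fixes \<gamma> :: "nat \<Rightarrow> nat"
  assumes K: "finite K" and N: "N > 0" "sum \<gamma> K = 2 * N"
  defines "F \<equiv> {f \<in> points N \<rightarrow>\<^sub>E K. \<forall>i\<in>K. card {x\<in>points N. f x = i} = \<gamma> i}"
  shows "rat_of_nat (\<Sum>f\<in>F. card {\<pi>\<in>fpf_involutions N. \<forall>x\<in>points N. f (\<pi> (std_cycle N x)) = f x}) =
    2 * rat_of_nat N * tree_count N (card {i\<in>K. \<gamma> i > 0} - 1)"
proof -
  \<comment> \<open>Colours of multiplicity 0 have no last exit and are dropped before passing to
    words.\<close>
  define I where "I = {i\<in>K. \<gamma> i > 0}"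
  define s where "s j = 2 * N - j" for j
  define W where "W f = map (f \<circ> s) [0..<2 * N]" for f :: "nat \<Rightarrow> nat"
  define M where "M w = {\<pi>\<in>matchings {..<2 * N}. \<forall>j<2 * N. w ! \<pi> j = w ! (Suc j mod (2 * N))}" for w :: "nat list"
  have I: "finite I" "\<And>i. i \<in> I \<Longrightarrow> \<gamma> i > 0" using K by (auto simp: I_def)
  have sumI: "sum \<gamma> I = 2 * N" unfolding N(2)[symmetric] I_def
    by (rule sum.mono_neutral_left) (use K in auto)
  have s: "bij_betw s {..<2 * N} (points N)"
    by (rule bij_betw_byWitness[where f' = s]) (auto simp: s_def)
  have cW: "count_list (W f) i = card {x\<in>points N. f x = i}" for f i
  proof -
    have "count_list (W f) i = card {j. j < 2 * N \<and> (f \<circ> s) j = i}"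
      unfolding W_def by (rule count_list_map_card)
    also have "bij_betw s {j. j < 2 * N \<and> (f \<circ> s) j = i} {x\<in>points N. f x = i}"
      by (rule bij_betw_byWitness[where f' = s]) (auto simp: s_def)
    then have "card {j. j < 2 * N \<and> (f \<circ> s) j = i} = card {x\<in>points N. f x = i}"
      by (rule bij_betw_same_card)
    finally show ?thesis .
  qed
  have cM: "card {\<pi>\<in>fpf_involutions N. \<forall>x\<in>points N. f (\<pi> (std_cycle N x)) = f x} = card (M (W f))" for f
    unfolding M_def fpf_involutions_eq
  proof (rule card_matchings_transfer[OF s, symmetric])
    fix \<pi> \<mu> assume \<pi>: "\<pi> \<in> matchings {..<2 * N}" and \<mu>: "\<mu> \<in> matchings (points N)"
      and eq: "\<And>x. x \<in> {..<2 * N} \<Longrightarrow> s (\<pi> x) = \<mu> (s x)"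
    have step: "std_cycle N (s (Suc j mod (2 * N))) = s j" if "j < 2 * N" for j
    proof (cases "Suc j = 2 * N")
      case True
      then have "s j = 1" "Suc j mod (2 * N) = 0" by (simp_all add: s_def)
      moreover have "std_cycle N (2 * N) = 1" using std_cycle_apply[OF that] True by simp
      ultimately show ?thesis by (simp add: s_def)
    next
      case False
      then have "std_cycle N (Suc (2 * N - Suc (Suc j))) = Suc (Suc (2 * N - Suc (Suc j)) mod (2 * N))"
        using that by (intro std_cycle_apply) auto
      then show ?thesis using that False by (simp add: s_def Suc_diff_Suc)
    qed
    have W: "W f ! j = f (s j)" if "j < 2 * N" for j using that by (simp add: W_def)
    have 1: "(W f ! \<pi> j = W f ! (Suc j mod (2 * N))) \<longleftrightarrow>
       f (\<mu> (std_cycle N (s (Suc j mod (2 * N))))) = f (s (Suc j mod (2 * N)))" if "j < 2 * N" for j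
      using that eq[of j] matchingsD(2)[OF \<pi>, of j] N step[OF that] by (simp add: W)
    have 2: "\<exists>j<2 * N. x = s (Suc j mod (2 * N))" if "x \<in> points N" for x
    proof (cases "x = 2 * N")
      case True
      then show ?thesis using N by (intro exI[of _ "2 * N - 1"]) (auto simp: s_def)
    next
      case False
      then have "Suc (2 * N - x - 1) = 2 * N - x" "x \<ge> 1" "x < 2 * N" using that by auto
      then show ?thesis by (intro exI[of _ "2 * N - x - 1"]) (auto simp: s_def)
    qed
    have 3: "s (Suc j mod (2 * N)) \<in> points N" if "j < 2 * N" for j
      using bij_betwE[OF s] N by auto
    show "(\<forall>j<2 * N. W f ! \<pi> j = W f ! (Suc j mod (2 * N))) \<longleftrightarrow>
       (\<forall>x\<in>points N. f (\<mu> (std_cycle N x)) = f x)"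
      using 1 2 3 by (metis (no_types, lifting))
  qed
  have bij: "bij_betw W F (words I \<gamma>)"
  proof (rule bij_betw_byWitness[where f' = "\<lambda>w. restrict (\<lambda>x. w ! s x) (points N)"])
    show "\<forall>f\<in>F. restrict (\<lambda>x. W f ! s x) (points N) = f"
      by (auto simp: F_def W_def s_def fun_eq_iff restrict_def PiE_def extensional_def)
    show "\<forall>w\<in>words I \<gamma>. W (restrict (\<lambda>x. w ! s x) (points N)) = w"
      using length_words[OF I(1)] sumI by (auto simp: W_def s_def intro!: nth_equalityI)
    show "W ` F \<subseteq> words I \<gamma>"
    proof safe
      fix f assume f: "f \<in> F"
      have "count_list (W f) i = \<gamma> i" if "i \<in> K" for i using f that unfolding cW by (auto simp: F_def)
      moreover have "set (W f) \<subseteq> K" using f bij_betwE[OF s] by (auto simp: W_def F_def)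
      ultimately show "W f \<in> words I \<gamma>"
        unfolding words_def I_def using count_list_0_iff[of "W f"] by fastforce
    qed
    show "(\<lambda>w. restrict (\<lambda>x. w ! s x) (points N)) ` words I \<gamma> \<subseteq> F"
    proof safe
      fix w assume w: "w \<in> words I \<gamma>"
      let ?f = "restrict (\<lambda>x. w ! s x) (points N)"
      have len: "length w = 2 * N" using length_words[OF I(1) w] sumI by simp
      have Ww: "W ?f = w" using len by (auto simp: W_def s_def intro!: nth_equalityI)
      have "card {x\<in>points N. ?f x = i} = \<gamma> i" if "i \<in> K" for i
      proof (cases "i \<in> I")
        case True
        then show ?thesis using w unfolding cW[symmetric] Ww by (auto simp: words_def)
      next
        case False
        then have "i \<notin> set w" using w by (auto simp: words_def)
        then show ?thesis using False that unfolding cW[symmetric] Ww by (auto simp: I_def)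
      qed
      moreover have "w ! s x \<in> K" if "x \<in> points N" for x
      proof -
        have "s x < length w" using that len by (auto simp: s_def)
        then have "w ! s x \<in> set w" by simp
        then show ?thesis using w by (auto simp: words_def I_def)
      qed
      ultimately show "?f \<in> F" unfolding F_def by (auto simp del: restrict_apply)
    qed
  qed
  have "(\<Sum>f\<in>F. card {\<pi>\<in>fpf_involutions N. \<forall>x\<in>points N. f (\<pi> (std_cycle N x)) = f x}) = (\<Sum>f\<in>F. card (M (W f)))"
    by (simp only: cM)
  also have "\<dots> = (\<Sum>w\<in>words I \<gamma>. card (M w))" by (rule sum.reindex_bij_betw[OF bij])
  also have "\<dots> = card (SIGMA w:words I \<gamma>. M w)"
    using I by (simp add: finite_words M_def finite_matchings)
  finally show ?thesis
    using card_word_matchings[OF I N(1) sumI] by (simp add: M_def I_def)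
qed

section \<open>Sums over weak compositions of products of local weights\<close>

definition weak_comps :: "'c set \<Rightarrow> nat \<Rightarrow> ('c \<Rightarrow> nat) set" where
  "weak_comps J n = {\<gamma> \<in> J \<rightarrow>\<^sub>E {..n}. sum \<gamma> J = n}"

lemma finite_weak_comps: "finite J \<Longrightarrow> finite (weak_comps J n)"
  by (simp add: weak_comps_def finite_PiE)

lemma sum_weak_comps_empty: "(\<Sum>\<gamma>\<in>weak_comps {} n. g \<gamma>) = of_bool (n = 0) * g (\<lambda>_. undefined)"
  for g :: "_ \<Rightarrow> nat"
  by (auto simp: weak_comps_def)

text \<open>The Cauchy product: the sum over \<open>weak_comps J n\<close> is the coefficient of
  \<open>x^n\<close> in the product of the power series with coefficients \<open>w i g\<close>, and
  one more factor is split off here.\<close>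

lemma sum_weak_comps_insert:
  fixes w :: "'c \<Rightarrow> nat \<Rightarrow> nat"
  assumes J: "finite J" "x \<notin> J"
  shows "(\<Sum>\<gamma>\<in>weak_comps (insert x J) n. \<Prod>i\<in>insert x J. w i (\<gamma> i)) =
    (\<Sum>g\<le>n. w x g * (\<Sum>\<gamma>\<in>weak_comps J (n - g). \<Prod>i\<in>J. w i (\<gamma> i)))"
proof -
  have upd: "(\<Sum>i\<in>J. (\<gamma>(x := g)) i) = sum \<gamma> J" "(\<Prod>i\<in>J. w i ((\<gamma>(x := g)) i)) = (\<Prod>i\<in>J. w i (\<gamma> i))"
    for \<gamma> g using J by (auto intro!: sum.cong prod.cong)
  have le: "\<gamma> i \<le> sum \<gamma> J" if "i \<in> J" for \<gamma> :: "'c \<Rightarrow> nat" and i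
    using J that by (simp add: member_le_sum)
  have bij: "bij_betw (\<lambda>(g, \<gamma>). \<gamma>(x := g)) (SIGMA g:{..n}. weak_comps J (n - g)) (weak_comps (insert x J) n)"
  proof (rule bij_betw_byWitness[where f' = "\<lambda>\<gamma>. (\<gamma> x, \<gamma>(x := undefined))"])
    show "\<forall>p\<in>SIGMA g:{..n}. weak_comps J (n - g).
        (\<lambda>\<gamma>. (\<gamma> x, \<gamma>(x := undefined))) ((\<lambda>(g, \<gamma>). \<gamma>(x := g)) p) = p"
      using J by (auto simp: weak_comps_def fun_eq_iff PiE_def extensional_def)
    show "\<forall>\<gamma>\<in>weak_comps (insert x J) n. (\<lambda>(g, \<gamma>). \<gamma>(x := g)) (\<gamma> x, \<gamma>(x := undefined)) = \<gamma>"
      by auto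
    show "(\<lambda>(g, \<gamma>). \<gamma>(x := g)) ` (SIGMA g:{..n}. weak_comps J (n - g)) \<subseteq> weak_comps (insert x J) n"
      using J by (auto simp: weak_comps_def upd simp del: fun_upd_apply)
        (auto simp: PiE_def Pi_def extensional_def intro: le_trans split: if_splits)
    show "(\<lambda>\<gamma>. (\<gamma> x, \<gamma>(x := undefined))) ` weak_comps (insert x J) n \<subseteq> (SIGMA g:{..n}. weak_comps J (n - g))"
    proof (rule image_subsetI)
      fix \<gamma> assume \<gamma>: "\<gamma> \<in> weak_comps (insert x J) n"
      then have "\<gamma> x + sum \<gamma> J = n" using J by (simp add: weak_comps_def)
      then have "\<gamma> x \<in> {..n}" by simp
      moreover have "\<gamma>(x := undefined) \<in> J \<rightarrow>\<^sub>E {..n - \<gamma> x}"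
      proof (rule PiE_I)
        fix i assume "i \<in> J"
        then show "(\<gamma>(x := undefined)) i \<in> {..n - \<gamma> x}" using le[of i \<gamma>] J \<open>\<gamma> x + sum \<gamma> J = n\<close> by auto
      next
        fix i assume "i \<notin> J"
        then show "(\<gamma>(x := undefined)) i = undefined" using \<gamma> by (auto simp: weak_comps_def)
      qed
      moreover have "sum (\<gamma>(x := undefined)) J = n - \<gamma> x"
        using \<open>\<gamma> x + sum \<gamma> J = n\<close> by (simp add: upd del: fun_upd_apply)
      ultimately show "(\<gamma> x, \<gamma>(x := undefined)) \<in> (SIGMA g:{..n}. weak_comps J (n - g))"
        by (simp add: weak_comps_def)
    qed
  qed
  have "(\<Sum>\<gamma>\<in>weak_comps (insert x J) n. \<Prod>i\<in>insert x J. w i (\<gamma> i)) =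
    (\<Sum>(g, \<gamma>)\<in>(SIGMA g:{..n}. weak_comps J (n - g)). \<Prod>i\<in>insert x J. w i ((\<gamma>(x := g)) i))"
    by (subst sum.reindex_bij_betw[OF bij, symmetric]) (simp add: case_prod_beta)
  also have "\<dots> = (\<Sum>g\<le>n. \<Sum>\<gamma>\<in>weak_comps J (n - g). w x g * (\<Prod>i\<in>J. w i (\<gamma> i)))"
    using J by (subst sum.Sigma[symmetric]) (auto simp: finite_weak_comps upd simp del: fun_upd_apply, simp)
  finally show ?thesis by (simp add: sum_distrib_left)
qed

text \<open>Both sides are the coefficient of \<open>x^n\<close> in the product of
  \<open>x^a / (1-x)^(a+1)\<close> and \<open>x^b / (1-x)^(b+1)\<close>. The induction uses Pascal's
  rule on the second binomial; \<open>b = 0\<close> is the hockey-stick identity.\<close>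

lemma sum_choose_convolution: "(\<Sum>g\<le>n. (g choose a) * ((n - g) choose b)) = Suc n choose (a + b + 1)"
proof (induction n arbitrary: b)
  case 0
  show ?case by (cases a; cases b) auto
next
  case (Suc n)
  show ?case
  proof (cases b)
    case 0
    then show ?thesis using sum_choose_upper[of a "Suc n"] by simp
  next
    case (Suc c)
    have "(\<Sum>g\<le>Suc n. (g choose a) * ((Suc n - g) choose b)) =
      (\<Sum>g\<le>n. (g choose a) * ((n - g) choose c) + (g choose a) * ((n - g) choose b))"
      by (simp add: Suc, rule sum.cong) (auto simp: Suc_diff_le algebra_simps)
    also have "\<dots> = (Suc n choose (a + c + 1)) + (Suc n choose (a + b + 1))"
      by (simp add: sum.distrib Suc.IH)
    finally show ?thesis by (simp add: Suc)
  qed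
qed

text \<open>The series \<open>x^(a i) / (1-x)^(a i + 1)\<close> multiply to
  \<open>x^s / (1-x)^(s + card J)\<close> with \<open>s = sum a J\<close>. The lower index
  \<open>n - s\<close> is chosen so that the formula survives truncated subtraction for empty
  \<open>J\<close>, where it must be 1 at \<open>n = 0\<close> and 0 otherwise.\<close>

lemma sum_weak_comps_choose:
  assumes "finite J"
  shows "(\<Sum>\<gamma>\<in>weak_comps J n. \<Prod>i\<in>J. \<gamma> i choose a i) =
    (if sum a J \<le> n then (n + card J - 1) choose (n - sum a J) else 0)"
  using assms
proof (induction J arbitrary: n rule: finite_induct)
  case empty
  show ?case by (subst sum_weak_comps_empty) auto
next
  case (insert x J)
  have "(\<Sum>\<gamma>\<in>weak_comps (insert x J) n. \<Prod>i\<in>insert x J. \<gamma> i choose a i) =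
    (\<Sum>g\<le>n. (g choose a x) * (if sum a J \<le> n - g then (n - g + card J - 1) choose (n - g - sum a J) else 0))"
    by (subst sum_weak_comps_insert[OF insert.hyps, where w = "\<lambda>i g. g choose a i"]) (simp only: insert.IH)
  also have "\<dots> = (if a x + sum a J \<le> n then (n + card J) choose (n - (a x + sum a J)) else 0)"
  proof (cases "J = {}")
    case True
    have "(\<Sum>g\<le>n. (g choose a x) * (if sum a J \<le> n - g then (n - g + card J - 1) choose (n - g - sum a J) else 0)) =
       (\<Sum>g\<in>{n}. (g choose a x))"
      by (rule sum.mono_neutral_cong_right) (auto simp: True)
    then show ?thesis using True binomial_symmetric[of "a x" n] by auto
  next
    case False
    then obtain q where q: "card J = Suc q" using insert.hyps by (metis card_0_eq not0_implies_Suc)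
    \<comment> \<open>Switching to the complementary lower index and summing up to
      \<open>n + q\<close>, where the new terms vanish, brings the sum into the shape of the
      convolution.\<close>
    have "(\<Sum>g\<le>n. (g choose a x) * (if sum a J \<le> n - g then (n - g + card J - 1) choose (n - g - sum a J) else 0)) =
       (\<Sum>g\<le>n + q. (g choose a x) * ((n + q - g) choose (q + sum a J)))"
    proof (rule sum.mono_neutral_cong_left)
      fix g assume g: "g \<in> {..n}"
      show "(g choose a x) * (if sum a J \<le> n - g then (n - g + card J - 1) choose (n - g - sum a J) else 0) =
         (g choose a x) * ((n + q - g) choose (q + sum a J))"
      proof (cases "sum a J \<le> n - g")
        case True
        then have "(n + q - g) choose (q + sum a J) = (n + q - g) choose (n + q - g - (q + sum a J))"
          using g by (intro binomial_symmetric) auto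
        moreover have "n + q - g - (q + sum a J) = n - g - sum a J" "n - g + card J - 1 = n + q - g" using g q by auto
        ultimately show ?thesis using True by simp
      next
        case False
        then have "n + q - g < q + sum a J" using g by auto
        then show ?thesis using False by simp
      qed
    qed (auto simp: binomial_eq_0)
    also have "\<dots> = Suc (n + q) choose (a x + (q + sum a J) + 1)" by (rule sum_choose_convolution)
    also have "\<dots> = (if a x + sum a J \<le> n then (n + card J) choose (n - (a x + sum a J)) else 0)"
      using q binomial_symmetric[of "a x + (q + sum a J) + 1" "Suc (n + q)"] by auto
    finally show ?thesis .
  qed
  finally show ?case using insert.hyps by simp
qed

text \<open>Multiplication by \<open>x / (1-x)\<close>, the series of a weight that only asks for
  positivity, read off on coefficients; Pascal's rule gives each step.\<close>

lemma sum_choose_diagonal_shift: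
  "(\<Sum>s<n. if B \<le> s then (s + q - 1) choose (s - B) else 0) =
    (if Suc B \<le> n then (n + q - 1) choose (n - Suc B) else 0)"
proof (induction n)
  case (Suc n)
  show ?case
  proof (cases "B < n")
    case True
    then have "n - B = Suc (n - Suc B)" "n + q = Suc (n + q - 1)" by auto
    then have "(n + q) choose (n - B) = ((n + q - 1) choose (n - Suc B)) + ((n + q - 1) choose (n - B))"
      by (metis binomial_Suc_Suc)
    then show ?thesis using Suc.IH True by simp
  qed (use Suc.IH in \<open>auto simp: not_less\<close>)
qed simp

text \<open>The three classes have the series \<open>x^a / (1-x)^(a+1)\<close>,
  \<open>x / (1-x)\<close> and 1. Each element of \<open>R\<close> raises the powers of
  \<open>x\<close> and of \<open>1 / (1-x)\<close> alike, which is why the upper index of the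
  binomial does not contain \<open>card R\<close>.\<close>

lemma sum_weak_comps_product:
  assumes fin: "finite A" "finite R" "finite Z" "A \<inter> R = {}" "(A \<union> R) \<inter> Z = {}"
    and w: "\<And>i g. i \<in> A \<Longrightarrow> w i g = g choose a i" "\<And>i g. i \<in> R \<Longrightarrow> w i g = of_bool (g > 0)"
      "\<And>i g. i \<in> Z \<Longrightarrow> w i g = of_bool (g = 0)"
  shows "(\<Sum>\<gamma>\<in>weak_comps (A \<union> R \<union> Z) n. \<Prod>i\<in>A \<union> R \<union> Z. w i (\<gamma> i)) =
    (if sum a A + card R \<le> n then (n + card A - 1) choose (n - sum a A - card R) else 0)"
proof -
  have A: "(\<Sum>\<gamma>\<in>weak_comps A n. \<Prod>i\<in>A. w i (\<gamma> i)) =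
      (if sum a A \<le> n then (n + card A - 1) choose (n - sum a A) else 0)" for n
    using sum_weak_comps_choose[OF fin(1), of a n] w(1) by simp
  have R: "(\<Sum>\<gamma>\<in>weak_comps (A \<union> R) n. \<Prod>i\<in>A \<union> R. w i (\<gamma> i)) =
      (if sum a A + card R \<le> n then (n + card A - 1) choose (n - sum a A - card R) else 0)" for n
    using fin(2,4) w(2)
  proof (induction R arbitrary: n rule: finite_induct)
    case empty
    then show ?case using A by simp
  next
    case (insert x R)
    have AR: "finite (A \<union> R)" "x \<notin> A \<union> R" using insert fin by auto
    have w1: "w x g = of_bool (g > 0)" for g using insert by simp
    have "(\<Sum>\<gamma>\<in>weak_comps (insert x (A \<union> R)) n. \<Prod>i\<in>insert x (A \<union> R). w i (\<gamma> i)) =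
      (\<Sum>g\<le>n. w x g * (\<Sum>\<gamma>\<in>weak_comps (A \<union> R) (n - g). \<Prod>i\<in>A \<union> R. w i (\<gamma> i)))"
      by (rule sum_weak_comps_insert[OF AR])
    also have "\<dots> = (\<Sum>g\<le>n. of_bool (g > 0) * (if sum a A + card R \<le> n - g then (n - g + card A - 1) choose (n - g - sum a A - card R) else 0))"
      using insert by (simp add: w1)
    also have "\<dots> = (\<Sum>s\<le>n. of_bool (n - s > 0) * (if sum a A + card R \<le> s then (s + card A - 1) choose (s - sum a A - card R) else 0))"
      by (rule sum.reindex_bij_witness[where i = "\<lambda>s. n - s" and j = "\<lambda>s. n - s"]) auto
    also have "\<dots> = (\<Sum>s<n. if sum a A + card R \<le> s then (s + card A - 1) choose (s - (sum a A + card R)) else 0)"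
      by (rule sum.mono_neutral_cong_right) auto
    also have "\<dots> = (if Suc (sum a A + card R) \<le> n then (n + card A - 1) choose (n - Suc (sum a A + card R)) else 0)"
      by (rule sum_choose_diagonal_shift)
    finally show ?case using insert.hyps by simp
  qed
  show ?thesis using fin(3,5) w(3)
  proof (induction Z arbitrary: n rule: finite_induct)
    case empty
    then show ?case using R by simp
  next
    case (insert x Z)
    have AR: "finite (A \<union> R \<union> Z)" "x \<notin> A \<union> R \<union> Z" using insert fin by auto
    have w1: "w x g = of_bool (g = 0)" for g using insert by simp
    have "(\<Sum>\<gamma>\<in>weak_comps (insert x (A \<union> R \<union> Z)) n. \<Prod>i\<in>insert x (A \<union> R \<union> Z). w i (\<gamma> i)) =
      (\<Sum>g\<le>n. w x g * (\<Sum>\<gamma>\<in>weak_comps (A \<union> R \<union> Z) (n - g). \<Prod>i\<in>A \<union> R \<union> Z. w i (\<gamma> i)))"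
      by (rule sum_weak_comps_insert[OF AR])
    also have "\<dots> = (\<Sum>g\<in>{0}. (\<Sum>\<gamma>\<in>weak_comps (A \<union> R \<union> Z) (n - g). \<Prod>i\<in>A \<union> R \<union> Z. w i (\<gamma> i)))"
      by (rule sum.mono_neutral_cong_right) (auto simp: w1)
    finally show ?case using insert by simp
  qed
qed

section \<open>The generating function at natural numbers\<close>

lemma card_list_choices:
  assumes "\<And>i. i < k \<Longrightarrow> finite (B i)"
  shows "card {xs. length xs = k \<and> (\<forall>i<k. xs ! i \<in> B i)} = (\<Prod>i<k. card (B i))"
proof -
  have "bij_betw (\<lambda>g. map g [0..<k]) (PiE {..<k} B) {xs. length xs = k \<and> (\<forall>i<k. xs ! i \<in> B i)}"
    by (rule bij_betw_byWitness[where f' = "\<lambda>xs. restrict (nth xs) {..<k}"])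
      (auto simp: fun_eq_iff PiE_def Pi_def extensional_def intro!: nth_equalityI)
  from bij_betw_same_card[OF this, symmetric] show ?thesis
    by (simp add: card_PiE)
qed

text \<open>A cycle meeting a block has its colour forced, consistently so exactly under separation;
  every other cycle is coloured freely. This turns a power with exponent \<open>uc\<close> into a
  number of colourings.\<close>

lemma card_cycle_colourings:
  fixes p :: "nat \<Rightarrow> nat" and K :: "nat set"
  assumes p: "p permutes S" and fin: "finite S" and K: "{..<length A} \<subseteq> K"
    and A: "\<And>i. i < length A \<Longrightarrow> A ! i \<subseteq> S"
  shows "card {f \<in> S \<rightarrow>\<^sub>E K. (\<forall>x\<in>S. f (p x) = f x) \<and> (\<forall>i<length A. \<forall>x\<in>A ! i. f x = i)} =
    (if \<forall>C\<in>cycles_of p S. \<forall>i<length A. \<forall>j<length A. C \<inter> A ! i \<noteq> {} \<and> C \<inter> A ! j \<noteq> {} \<longrightarrow> i = j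
     then card K ^ card {C \<in> cycles_of p S. C \<inter> \<Union>(set A) = {}} else 0)"
    (is "card ?F = (if ?sep then _ else _)")
proof -
  define U where "U = {C \<in> cycles_of p S. C \<inter> \<Union>(set A) = {}}"
  have perm: "permutation p" using p fin by (auto simp: permutation_permutes)
  have self: "x \<in> orbit p x" for x by (rule permutation_self_in_orbit[OF perm])
  have orb: "orbit p y = orbit p x" if "y \<in> orbit p x" for x y
    using orbit_cyclic_eq3[OF cyclic_on_orbit[OF p fin] that] .
  have step: "orbit p (p x) = orbit p x" for x by (rule permutation_orbit_step[OF perm])
  have sub: "orbit p x \<subseteq> S" if "x \<in> S" for x by (rule permutes_orbit_subset[OF p that])
  have const: "f y = f x" if "\<forall>x\<in>S. f (p x) = f x" "x \<in> S" "y \<in> orbit p x" for f :: "nat \<Rightarrow> nat" and x y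
    using that(3)
  proof induction
    case base
    then show ?case using that by simp
  next
    case (step y)
    then show ?case using that sub[of x] by auto
  qed
  show ?thesis
  proof (cases ?sep)
    case False
    then obtain C i j where C: "C \<in> cycles_of p S" "i < length A" "j < length A" "C \<inter> A ! i \<noteq> {}" "C \<inter> A ! j \<noteq> {}" "i \<noteq> j"
      by auto
    then obtain x a b where x: "x \<in> S" "C = orbit p x" "a \<in> orbit p x" "a \<in> A ! i" "b \<in> orbit p x" "b \<in> A ! j"
      by (auto simp: cycles_of_def)
    have "f \<notin> ?F" for f
    proof
      assume f: "f \<in> ?F"
      then have "f a = f b" using const[of f x a] const[of f x b] x by auto
      then show False using f x C by auto
    qed
    then have "?F = {}" by blast
    then show ?thesis by (simp only: if_not_P[OF False] card.empty)
  next
    case sep: True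
    \<comment> \<open>The forced colour, meaningful only for cycles that meet a block.\<close>
    define lab where "lab C = (SOME i. i < length A \<and> C \<inter> A ! i \<noteq> {})" for C
    have lab: "lab (orbit p x) = i" if "x \<in> S" "i < length A" "orbit p x \<inter> A ! i \<noteq> {}" for x i
      unfolding lab_def
    proof (rule some_equality)
      show "i < length A \<and> orbit p x \<inter> A ! i \<noteq> {}" using that by simp
      fix j assume "j < length A \<and> orbit p x \<inter> A ! j \<noteq> {}"
      then show "j = i" using sep that by (auto simp: cycles_of_def)
    qed
    have nU: "\<exists>i<length A. orbit p x \<inter> A ! i \<noteq> {}" if "x \<in> S" "orbit p x \<notin> U" for x
      using that unfolding U_def cycles_of_def by (auto simp: in_set_conv_nth) blast
    have labK: "lab (orbit p x) \<in> K" if "x \<in> S" "orbit p x \<notin> U" for x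
      using nU[OF that] lab[OF that(1)] K by auto
    define rep where "rep C = (SOME x. x \<in> C)" for C :: "nat set"
    have rep: "rep C \<in> C" "rep C \<in> S" "orbit p (rep C) = C" if CU: "C \<in> U" for C
    proof -
      obtain x where x: "x \<in> S" "C = orbit p x" using CU by (auto simp: U_def cycles_of_def)
      show "rep C \<in> C" unfolding rep_def using self[of x] x by (auto intro: someI)
      then show "rep C \<in> S" "orbit p (rep C) = C" using x sub[of x] orb[of "rep C" x] by auto
    qed
    define \<Phi> where "\<Phi> f = restrict (\<lambda>C. f (rep C)) U" for f :: "nat \<Rightarrow> nat"
    define \<Psi> where "\<Psi> g = restrict (\<lambda>x. if orbit p x \<in> U then g (orbit p x) else lab (orbit p x)) S" for g :: "nat set \<Rightarrow> nat"
    have "bij_betw \<Phi> ?F (U \<rightarrow>\<^sub>E K)"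
    proof (rule bij_betw_byWitness[where f' = \<Psi>])
      show "\<forall>f\<in>?F. \<Psi> (\<Phi> f) = f"
      proof
        fix f assume f: "f \<in> ?F"
        then have fp: "\<forall>x\<in>S. f (p x) = f x" and fA: "\<And>i x. i < length A \<Longrightarrow> x \<in> A ! i \<Longrightarrow> f x = i"
          and fE: "f \<in> extensional S"
          by (simp_all add: PiE_def)
        show "\<Psi> (\<Phi> f) = f"
        proof
          fix x
          show "\<Psi> (\<Phi> f) x = f x"
          proof (cases "x \<in> S")
            case True
            show ?thesis
            proof (cases "orbit p x \<in> U")
              case 1: True
              then have "f (rep (orbit p x)) = f x" by (intro const[OF fp True] rep(1) 1)
              then show ?thesis using 1 True by (simp add: \<Psi>_def \<Phi>_def)
            next
              case 2: False
              obtain i y where i: "i < length A" "y \<in> orbit p x" "y \<in> A ! i" using nU[OF True 2] by auto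
              then have "lab (orbit p x) = i" using lab[OF True, of i] by auto
              moreover have "f y = i" using i by (intro fA)
              moreover have "f y = f x" using i by (intro const[OF fp True])
              ultimately show ?thesis using True 2 by (simp add: \<Psi>_def)
            qed
          qed (use fE in \<open>simp add: \<Psi>_def extensional_def\<close>)
        qed
      qed
      show "\<forall>g\<in>U \<rightarrow>\<^sub>E K. \<Phi> (\<Psi> g) = g"
        using rep by (auto simp: \<Psi>_def \<Phi>_def fun_eq_iff PiE_def extensional_def)
      show "\<Phi> ` ?F \<subseteq> U \<rightarrow>\<^sub>E K" using rep by (auto simp: \<Phi>_def)
      show "\<Psi> ` (U \<rightarrow>\<^sub>E K) \<subseteq> ?F"
      proof (rule image_subsetI)
        fix g assume g: "g \<in> U \<rightarrow>\<^sub>E K"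
        have "\<Psi> g (p x) = \<Psi> g x" if "x \<in> S" for x
          using that step[of x] permutes_in_image[OF p, of x] by (simp add: \<Psi>_def)
        moreover have "\<Psi> g x = i" if "i < length A" "x \<in> A ! i" for i x
        proof -
          have x: "x \<in> S" using A that by auto
          have ne: "orbit p x \<inter> A ! i \<noteq> {}" using self[of x] that by auto
          moreover have "A ! i \<in> set A" using that by simp
          ultimately have "orbit p x \<notin> U" unfolding U_def by blast
          then show ?thesis using x lab[OF x that(1) ne] by (simp add: \<Psi>_def)
        qed
        moreover have "\<Psi> g \<in> S \<rightarrow>\<^sub>E K" using g labK by (auto simp: \<Psi>_def)
        ultimately show "\<Psi> g \<in> ?F" by blast
      qed
    qed
    then have "card ?F = card (U \<rightarrow>\<^sub>E K)" by (rule bij_betw_same_card)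
    also have "\<dots> = card K ^ card U"
      by (rule card_funcsetE) (use fin in \<open>auto simp: U_def cycles_of_def\<close>)
    finally show ?thesis using sep by (simp add: U_def)
  qed
qed

lemma finite_set_tuples: "finite (set_tuples N \<alpha>)"
proof (rule finite_subset)
  have "X \<subseteq> points N" if "A \<in> set_tuples N \<alpha>" "X \<in> set A" for A X
    using that unfolding set_tuples_def in_set_conv_nth by blast
  then show "set_tuples N \<alpha> \<subseteq> {A. set A \<subseteq> Pow (points N) \<and> length A = length \<alpha>}"
    by (auto simp: set_tuples_def)
  show "finite {A. set A \<subseteq> Pow (points N) \<and> length A = length \<alpha>}"
    by (rule finite_lists_length_eq) simp
qed

text \<open>Blocks lying in different colour classes are disjoint automatically, so they are chosen
  independently.\<close>

lemma card_set_tuples_colouring: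
  "card {A\<in>set_tuples N \<alpha>. \<forall>i<length A. \<forall>x\<in>A ! i. f x = i} =
    (\<Prod>i<length \<alpha>. card {x\<in>points N. f x = i} choose (\<alpha> ! i))"
proof -
  define B where "B i = {X. X \<subseteq> {x\<in>points N. f x = i} \<and> card X = \<alpha> ! i}" for i
  have "{A\<in>set_tuples N \<alpha>. \<forall>i<length A. \<forall>x\<in>A ! i. f x = i} =
     {A. length A = length \<alpha> \<and> (\<forall>i<length \<alpha>. A ! i \<in> B i)}"
  proof (intro set_eqI iffI)
    fix A assume "A \<in> {A\<in>set_tuples N \<alpha>. \<forall>i<length A. \<forall>x\<in>A ! i. f x = i}"
    then have "length A = length \<alpha>" "\<And>i. i < length \<alpha> \<Longrightarrow> A ! i \<subseteq> points N"
      "\<And>i. i < length \<alpha> \<Longrightarrow> card (A ! i) = \<alpha> ! i" "\<And>i x. i < length \<alpha> \<Longrightarrow> x \<in> A ! i \<Longrightarrow> f x = i"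
      by (simp_all add: set_tuples_def)
    then show "A \<in> {A. length A = length \<alpha> \<and> (\<forall>i<length \<alpha>. A ! i \<in> B i)}"
      unfolding B_def by blast
  next
    fix A assume "A \<in> {A. length A = length \<alpha> \<and> (\<forall>i<length \<alpha>. A ! i \<in> B i)}"
    then have len: "length A = length \<alpha>" and A: "\<And>i. i < length \<alpha> \<Longrightarrow> A ! i \<subseteq> {x\<in>points N. f x = i} \<and> card (A ! i) = \<alpha> ! i"
      by (simp_all add: B_def)
    have "A ! i \<inter> A ! j = {}" if "i < length \<alpha>" "j < length \<alpha>" "i \<noteq> j" for i j
      using A[OF that(1)] A[OF that(2)] that(3) by blast
    then show "A \<in> {A\<in>set_tuples N \<alpha>. \<forall>i<length A. \<forall>x\<in>A ! i. f x = i}"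
      unfolding set_tuples_def mem_Collect_eq len using len A by blast
  qed
  moreover have "card (B i) = card {x\<in>points N. f x = i} choose (\<alpha> ! i)" "finite (B i)" for i
    unfolding B_def by (rule n_subsets) auto
  ultimately show ?thesis by (simp only: card_list_choices)
qed

lemma card_eq_sum_of_bool: "finite X \<Longrightarrow> card {x\<in>X. P x} = (\<Sum>x\<in>X. of_bool (P x))"
  by (simp add: Int_def)

text \<open>Summing over the colouring outermost separates the conditions on \<open>\<pi>\<close>
  and on \<open>A\<close>, so the inner sum becomes a product. The bound on \<open>L\<close> leaves
  room for one reserved colour per block.\<close>

lemma H_of_nat:
  fixes L :: nat
  assumes L: "length \<alpha> \<le> L"
  shows "H N \<alpha> (of_nat L :: 'a :: field_char_0) =
    of_nat (\<Sum>f\<in>points N \<rightarrow>\<^sub>E {..<L}. card {\<pi>\<in>fpf_involutions N. \<forall>x\<in>points N. f (\<pi> (std_cycle N x)) = f x} *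
      (\<Prod>i<length \<alpha>. card {x\<in>points N. f x = i} choose (\<alpha> ! i)))"
proof -
  let ?P = "fpf_involutions N" and ?T = "set_tuples N \<alpha>" and ?F = "points N \<rightarrow>\<^sub>E {..<L}"
  define R where "R \<pi> f \<longleftrightarrow> (\<forall>x\<in>points N. f (\<pi> (std_cycle N x)) = f x)" for \<pi> and f :: "nat \<Rightarrow> nat"
  define Q where "Q A f \<longleftrightarrow> (\<forall>i<length A. \<forall>x\<in>A ! i. f x = i)" for A and f :: "nat \<Rightarrow> nat"
  have fin: "finite ?P" "finite ?T" "finite ?F"
    by (simp_all add: fpf_involutions_eq finite_matchings finite_set_tuples finite_PiE)
  have c: "card {f\<in>?F. R \<pi> f \<and> Q A f} = (if separated N A (\<pi> \<circ> std_cycle N) then L ^ uc N \<pi> A else 0)"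
    if "\<pi> \<in> ?P" "A \<in> ?T" for \<pi> A
  proof -
    have "\<pi> \<circ> std_cycle N permutes points N"
      using that std_cycle_permutes by (intro permutes_compose) (auto simp: fpf_involutions_def)
    moreover have "{..<length A} \<subseteq> {..<L}" "\<And>i. i < length A \<Longrightarrow> A ! i \<subseteq> points N"
      using that L by (auto simp: set_tuples_def)
    ultimately show ?thesis
      unfolding R_def Q_def separated_def uc_def
      using card_cycle_colourings[of "\<pi> \<circ> std_cycle N" "points N" A "{..<L}"]
      by (simp only: o_apply card_lessThan finite_atLeastAtMost)
  qed
  have "H N \<alpha> (of_nat L :: 'a) =
    (\<Sum>x\<in>separated_pairs N \<alpha>. case x of (\<pi>, A) \<Rightarrow> of_nat (L ^ uc N \<pi> A))"
    by (simp add: H_def)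
  also have "\<dots> = (\<Sum>x\<in>?P \<times> ?T. case x of (\<pi>, A) \<Rightarrow> of_nat (card {f\<in>?F. R \<pi> f \<and> Q A f}))"
    by (rule sum.mono_neutral_cong_left) (use fin c in \<open>auto simp: separated_pairs_def split: if_splits\<close>)
  also have "\<dots> = of_nat (\<Sum>\<pi>\<in>?P. \<Sum>A\<in>?T. card {f\<in>?F. R \<pi> f \<and> Q A f})"
    by (simp add: sum.cartesian_product case_prod_beta)
  also have "(\<Sum>\<pi>\<in>?P. \<Sum>A\<in>?T. card {f\<in>?F. R \<pi> f \<and> Q A f}) =
      (\<Sum>\<pi>\<in>?P. \<Sum>A\<in>?T. \<Sum>f\<in>?F. of_bool (R \<pi> f) * of_bool (Q A f))"
    by (simp only: card_eq_sum_of_bool[OF fin(3)] of_bool_conj)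
  also have "\<dots> = (\<Sum>f\<in>?F. (\<Sum>\<pi>\<in>?P. of_bool (R \<pi> f)) * (\<Sum>A\<in>?T. of_bool (Q A f)))"
    by (simp only: sum_product sum.swap[of _ ?F ?T] sum.swap[of _ ?F ?P])
  also have "\<dots> = (\<Sum>f\<in>?F. card {\<pi>\<in>?P. R \<pi> f} * card {A\<in>?T. Q A f})"
    by (simp only: card_eq_sum_of_bool[OF fin(1)] card_eq_sum_of_bool[OF fin(2)])
  finally show ?thesis
    unfolding R_def Q_def card_set_tuples_colouring .
qed

lemma sum_Pow_card:
  fixes g :: "nat \<Rightarrow> 'a :: comm_semiring_1"
  assumes "finite X"
  shows "(\<Sum>R\<in>Pow X. g (card R)) = (\<Sum>r\<le>card X. of_nat (card X choose r) * g r)"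
proof -
  have "(\<Sum>R\<in>Pow X. g (card R)) = (\<Sum>r\<le>card X. \<Sum>R\<in>{R\<in>Pow X. card R = r}. g (card R))"
    by (rule sum.group[symmetric]) (use assms in \<open>auto intro: card_mono\<close>)
  also have "\<dots> = (\<Sum>r\<le>card X. of_nat (card X choose r) * g r)"
    using n_subsets[OF assms] by (intro sum.cong) auto
  finally show ?thesis .
qed

text \<open>Colourings are grouped by type. The number of matchings for a type depends on how many
  colours are used, which is not a product of local weights; fixing the set \<open>R\<close> of
  unreserved colours in use makes it one.\<close>

lemma sum_colourings:
  assumes \<alpha>: "composition \<alpha> m k" and N: "N > 0"
  shows "rat_of_nat (\<Sum>f\<in>points N \<rightarrow>\<^sub>E {..<k + T}. card {\<pi>\<in>fpf_involutions N. \<forall>x\<in>points N. f (\<pi> (std_cycle N x)) = f x} *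
      (\<Prod>i<k. card {x\<in>points N. f x = i} choose (\<alpha> ! i))) =
    (\<Sum>r\<le>T. of_nat (T choose r) * (2 * of_nat N * tree_count N (k + r - 1) *
       of_nat (if m + r \<le> 2 * N then (2 * N + k - 1) choose (2 * N - m - r) else 0)))"
proof -
  let ?K = "{..<k + T}" and ?n = "2 * N"
  let ?F = "points N \<rightarrow>\<^sub>E ?K"
  define c where "c f = card {\<pi>\<in>fpf_involutions N. \<forall>x\<in>points N. f (\<pi> (std_cycle N x)) = f x}" for f :: "nat \<Rightarrow> nat"
  define ty where "ty f = restrict (\<lambda>i. card {x\<in>points N. f x = i}) ?K" for f :: "nat \<Rightarrow> nat"
  define t where "t l = 2 * rat_of_nat N * tree_count N (l - 1)" for l
  define X where "X = {k..<k + T}"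
  \<comment> \<open>For fixed \<open>R\<close> the requirement that exactly the unreserved colours
    in \<open>R\<close> are used splits into one factor per colour.\<close>
  define w where "w R i g = (if i < k then g choose (\<alpha> ! i) else of_bool (i \<in> R \<longleftrightarrow> g > 0))" for R i g
  have sz: "length \<alpha> = k" "\<And>i. i < k \<Longrightarrow> \<alpha> ! i > 0" "(\<Sum>i<k. \<alpha> ! i) = m"
    using \<alpha> by (auto simp: composition_def sum_list_sum_nth atLeast0LessThan)
  have fF: "finite ?F" by (simp add: finite_PiE)
  have ty: "ty ` ?F \<subseteq> weak_comps ?K ?n"
  proof safe
    fix f assume f: "f \<in> ?F"
    have "sum (ty f) ?K = (\<Sum>i\<in>?K. card {x\<in>points N. f x = i})" by (simp add: ty_def)
    also have "\<dots> = (\<Sum>i\<in>?K. \<Sum>x\<in>{x\<in>points N. f x = i}. 1)" by simp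
    also have "\<dots> = (\<Sum>x\<in>points N. 1)" by (rule sum.group) (use f in auto)
    finally have "sum (ty f) ?K = ?n" by simp
    moreover have "card {x\<in>points N. f x = i} \<le> card (points N)" for i by (rule card_mono) auto
    ultimately show "ty f \<in> weak_comps ?K ?n" by (auto simp: weak_comps_def ty_def)
  qed
  have c_ty: "rat_of_nat (\<Sum>f\<in>{f\<in>?F. ty f = \<gamma>}. c f) = t (card {i\<in>?K. \<gamma> i > 0})"
    if \<gamma>: "\<gamma> \<in> weak_comps ?K ?n" for \<gamma>
  proof -
    have "{f\<in>?F. ty f = \<gamma>} = {f\<in>?F. \<forall>i\<in>?K. card {x\<in>points N. f x = i} = \<gamma> i}"
      using \<gamma> by (auto simp: ty_def weak_comps_def fun_eq_iff PiE_def extensional_def)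
    then show ?thesis using card_colouring_matchings[of ?K N \<gamma>] N \<gamma> by (simp add: c_def t_def weak_comps_def)
  qed
  have expand: "t (card {i\<in>?K. \<gamma> i > 0}) * of_nat (\<Prod>i<k. \<gamma> i choose (\<alpha> ! i)) =
      (\<Sum>R\<in>Pow X. t (k + card R) * of_nat (\<Prod>i\<in>?K. w R i (\<gamma> i)))" for \<gamma> :: "nat \<Rightarrow> nat"
  proof -
    define R0 where "R0 = {i\<in>X. \<gamma> i > 0}"
    have KX: "?K = {..<k} \<union> X" "{..<k} \<inter> X = {}" by (auto simp: X_def)
    have w: "(\<Prod>i\<in>?K. w R i (\<gamma> i)) = (\<Prod>i<k. \<gamma> i choose (\<alpha> ! i)) * of_bool (R = R0)" if "R \<in> Pow X" for R
    proof -
      have "(\<Prod>i\<in>?K. w R i (\<gamma> i)) = (\<Prod>i<k. w R i (\<gamma> i)) * (\<Prod>i\<in>X. w R i (\<gamma> i))"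
        unfolding KX(1) by (rule prod.union_disjoint) (use KX in \<open>auto simp: X_def\<close>)
      also have "(\<Prod>i<k. w R i (\<gamma> i)) = (\<Prod>i<k. \<gamma> i choose (\<alpha> ! i))" by (simp add: w_def)
      also have "(\<Prod>i\<in>X. w R i (\<gamma> i)) = (\<Prod>i\<in>X. of_bool (i \<in> R \<longleftrightarrow> \<gamma> i > 0))"
        by (rule prod.cong) (auto simp: w_def X_def)
      also have "\<dots> = of_bool (\<forall>i\<in>X. i \<in> R \<longleftrightarrow> \<gamma> i > 0)"
        by (cases "\<forall>i\<in>X. i \<in> R \<longleftrightarrow> \<gamma> i > 0") (auto simp: X_def)
      also have "(\<forall>i\<in>X. i \<in> R \<longleftrightarrow> \<gamma> i > 0) \<longleftrightarrow> R = R0" using that by (auto simp: R0_def)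
      finally show ?thesis .
    qed
    have "(\<Sum>R\<in>Pow X. t (k + card R) * of_nat (\<Prod>i\<in>?K. w R i (\<gamma> i))) =
        (\<Sum>R\<in>{R0}. t (k + card R) * of_nat (\<Prod>i\<in>?K. w R i (\<gamma> i)))"
      by (rule sum.mono_neutral_right) (auto simp: w, auto simp: X_def R0_def)
    also have "\<dots> = t (k + card R0) * of_nat (\<Prod>i<k. \<gamma> i choose (\<alpha> ! i))"
      by (simp add: w R0_def)
    also have "\<dots> = t (card {i\<in>?K. \<gamma> i > 0}) * of_nat (\<Prod>i<k. \<gamma> i choose (\<alpha> ! i))"
    proof (cases "\<forall>i<k. \<gamma> i > 0")
      case True
      then have "{i\<in>?K. \<gamma> i > 0} = {..<k} \<union> R0" unfolding KX(1) by (auto simp: R0_def)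
      moreover have "card ({..<k} \<union> R0) = k + card R0"
        by (subst card_Un_disjoint) (auto simp: R0_def X_def)
      ultimately show ?thesis by simp
    next
      case False
      then obtain i where "i < k" "\<gamma> i = 0" by auto
      then have "i \<in> {..<k}" "\<gamma> i choose (\<alpha> ! i) = 0" using sz(2)[of i] by auto
      then have "(\<Prod>i<k. \<gamma> i choose (\<alpha> ! i)) = 0" by (intro prod_zero) auto
      then show ?thesis by simp
    qed
    finally show ?thesis by simp
  qed
  have conv: "(\<Sum>\<gamma>\<in>weak_comps ?K ?n. \<Prod>i\<in>?K. w R i (\<gamma> i)) =
      (if m + card R \<le> ?n then (?n + k - 1) choose (?n - m - card R) else 0)" if "R \<in> Pow X" for R
  proof -
    have K: "?K = {..<k} \<union> R \<union> (X - R)" using that by (auto simp: X_def)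
    have "finite R" using that finite_subset by (auto simp: X_def)
    then show ?thesis
      unfolding K
      by (subst sum_weak_comps_product[where a = "nth \<alpha>"])
        (use that in \<open>auto simp: w_def X_def sz of_bool_def\<close>)
  qed
  have "rat_of_nat (\<Sum>f\<in>?F. c f * (\<Prod>i<k. card {x\<in>points N. f x = i} choose (\<alpha> ! i))) =
     rat_of_nat (\<Sum>f\<in>?F. c f * (\<Prod>i<k. ty f i choose (\<alpha> ! i)))"
    by (intro arg_cong[where f = rat_of_nat] sum.cong refl arg_cong2[where f = "(*)"] prod.cong)
      (auto simp: ty_def)
  also have "\<dots> = rat_of_nat (\<Sum>\<gamma>\<in>weak_comps ?K ?n. \<Sum>f\<in>{f\<in>?F. ty f = \<gamma>}. c f * (\<Prod>i<k. ty f i choose (\<alpha> ! i)))"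
    by (subst sum.group[OF fF _ ty]) (simp_all add: finite_weak_comps)
  also have "\<dots> = (\<Sum>\<gamma>\<in>weak_comps ?K ?n. rat_of_nat (\<Sum>f\<in>{f\<in>?F. ty f = \<gamma>}. c f) * of_nat (\<Prod>i<k. \<gamma> i choose (\<alpha> ! i)))"
    unfolding of_nat_sum sum_distrib_right by (intro sum.cong refl) auto
  also have "\<dots> = (\<Sum>\<gamma>\<in>weak_comps ?K ?n. \<Sum>R\<in>Pow X. t (k + card R) * of_nat (\<Prod>i\<in>?K. w R i (\<gamma> i)))"
    by (intro sum.cong refl) (simp only: c_ty expand)
  also have "\<dots> = (\<Sum>R\<in>Pow X. t (k + card R) * of_nat (\<Sum>\<gamma>\<in>weak_comps ?K ?n. \<Prod>i\<in>?K. w R i (\<gamma> i)))"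
    by (subst sum.swap) (simp only: of_nat_sum sum_distrib_left)
  also have "\<dots> = (\<Sum>R\<in>Pow X. t (k + card R) * of_nat (if m + card R \<le> ?n then (?n + k - 1) choose (?n - m - card R) else 0))"
    by (intro sum.cong refl) (simp only: conv)
  also have "\<dots> = (\<Sum>r\<le>card X. of_nat (card X choose r) * (t (k + r) * of_nat (if m + r \<le> ?n then (?n + k - 1) choose (?n - m - r) else 0)))"
    by (rule sum_Pow_card) (simp add: X_def)
  finally show ?thesis unfolding c_def t_def by (simp add: X_def)
qed

section \<open>Polynomial extension\<close>

definition gbinomial_poly :: "nat \<Rightarrow> 'a :: field_char_0 poly" where
  "gbinomial_poly r = smult (1 / fact r) (\<Prod>i=0..<r. [:- of_nat i, 1:])"

lemma poly_gbinomial_poly: "poly (gbinomial_poly r) t = t gchoose r"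
  by (simp add: gbinomial_poly_def gbinomial_prod_rev poly_prod)

lemma poly_eq_of_nat:
  fixes p q :: "'a :: field_char_0 poly"
  assumes "\<And>n. poly p (of_nat n) = poly q (of_nat n)"
  shows "p = q"
proof (rule ccontr)
  assume "p \<noteq> q"
  then have "finite {x. poly (p - q) x = 0}" by (intro poly_roots_finite) simp
  moreover have "range of_nat \<subseteq> {x. poly (p - q) x = 0}" using assms by auto
  ultimately have "finite (range (of_nat :: nat \<Rightarrow> 'a))" by (rule rev_finite_subset)
  then show False using range_inj_infinite[OF inj_of_nat] by blast
qed

definition H_coeff :: "nat \<Rightarrow> nat \<Rightarrow> nat \<Rightarrow> nat \<Rightarrow> rat" where
  "H_coeff N m k r = 2 * of_nat N * tree_count N (k + r - 1) *
     of_nat (if m + r \<le> 2 * N then (2 * N + k - 1) choose (2 * N - m - r) else 0)"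

lemma H_expansion:
  fixes t :: "'a :: field_char_0"
  assumes \<alpha>: "composition \<alpha> m k" and N: "N > 0"
  shows "H N \<alpha> (t + of_nat k) = (\<Sum>r\<le>2 * N. (t gchoose r) * of_rat (H_coeff N m k r))"
proof -
  define P where "P = (\<Sum>(\<pi>, A)\<in>separated_pairs N \<alpha>. [:of_nat k :: 'a, 1:] ^ uc N \<pi> A)"
  define Q where "Q = (\<Sum>r\<le>2 * N. smult (of_rat (H_coeff N m k r) :: 'a) (gbinomial_poly r))"
  have P: "poly P x = H N \<alpha> (x + of_nat k)" for x
    by (simp add: P_def H_def poly_sum case_prod_beta add.commute)
  have Q: "poly Q x = (\<Sum>r\<le>2 * N. (x gchoose r) * of_rat (H_coeff N m k r))" for x
    by (simp add: Q_def poly_sum poly_gbinomial_poly mult.commute)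
  have "poly P (of_nat T) = poly Q (of_nat T)" for T
  proof -
    have len: "length \<alpha> = k" using \<alpha> by (simp add: composition_def)
    define X where "X = (\<Sum>f\<in>points N \<rightarrow>\<^sub>E {..<k + T}. card {\<pi>\<in>fpf_involutions N. \<forall>x\<in>points N. f (\<pi> (std_cycle N x)) = f x} *
      (\<Prod>i<k. card {x\<in>points N. f x = i} choose (\<alpha> ! i)))"
    have "H N \<alpha> (of_nat T + of_nat k :: 'a) = H N \<alpha> (of_nat (k + T))" by (simp add: add.commute)
    also have "\<dots> = of_nat X" unfolding X_def using H_of_nat[of \<alpha> "k + T" N] len by simp
    also have "\<dots> = of_rat (rat_of_nat X)" by simp
    also have "rat_of_nat X = (\<Sum>r\<le>T. of_nat (T choose r) * H_coeff N m k r)"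
      unfolding X_def H_coeff_def by (rule sum_colourings[OF \<alpha> N])
    \<comment> \<open>The range must not depend on \<open>T\<close> if the sum is to be a fixed
      polynomial: \<open>T choose r\<close> vanishes above \<open>T\<close>, and
      \<open>H_coeff\<close> vanishes above \<open>2N\<close>.\<close>
    also have "\<dots> = (\<Sum>r\<le>2 * N + T. of_nat (T choose r) * H_coeff N m k r)"
      by (rule sum.mono_neutral_left) (auto simp: binomial_eq_0)
    also have "\<dots> = (\<Sum>r\<le>2 * N. of_nat (T choose r) * H_coeff N m k r)"
      by (rule sum.mono_neutral_right) (auto simp: H_coeff_def)
    also have "of_rat \<dots> = (\<Sum>r\<le>2 * N. (of_nat T gchoose r) * of_rat (H_coeff N m k r) :: 'a)"
      by (simp add: of_rat_sum of_rat_mult) (simp add: binomial_gbinomial)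
    finally show ?thesis by (simp add: P Q)
  qed
  then have "P = Q" by (rule poly_eq_of_nat)
  then show ?thesis using P Q by metis
qed

lemma of_rat_fact: "of_rat (fact n) = fact n"
  by (metis of_nat_fact of_rat_of_nat_eq)

lemma of_rat_H_coeff:
  assumes "N > 0" "k = 0 \<longrightarrow> m = 0"
  shows "(of_rat (H_coeff N m k r) :: 'a :: field_char_0) =
    (if m + r \<le> 2 * N \<and> k + r \<le> N + 1 then of_nat N * (of_nat ((2 * N + k - 1) choose (2 * N - m - r)) *
       2 powi (int k + int r - int N) * (fact (2 * N - k - r) / fact (N + 1 - k - r))) else 0)"
\<comment> \<open>Here \<open>k + r - 1\<close> is truncated, but then \<open>m = 0\<close> and the
  binomial of \<open>2N - 1\<close> over \<open>2N\<close> makes both sides 0.\<close>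
proof (cases "k + r = 0")
  case True
  then have "k = 0" "r = 0" "m = 0" using assms by auto
  then show ?thesis using assms by (simp add: H_coeff_def binomial_eq_0)
next
  case False
  show ?thesis
  proof (cases "k + r \<le> N + 1")
    case True
    define d where "d = N + 1 - k - r"
    have "N - (k + r - 1) = d" "2 * N - (k + r - 1) - 1 = 2 * N - k - r" "k + r - 1 \<le> N"
      using True False by (auto simp: d_def)
    then have tc: "of_rat (tree_count N (k + r - 1)) = (fact (2 * N - k - r) / (2 ^ d * fact d) :: 'a)"
      by (simp add: tree_count_def of_rat_divide of_rat_mult of_rat_power of_rat_fact)
    \<comment> \<open>The 2 in \<open>H_coeff\<close> raises the exponent of 2 from
      \<open>- d\<close> to \<open>1 - d\<close>.\<close>
    have "int k + int r - int N = 1 - int d" using True by (simp add: d_def)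
    then have "2 powi (int k + int r - int N) = (2 / 2 ^ d :: 'a)" by (simp add: power_int_diff)
    then show ?thesis using True unfolding H_coeff_def of_rat_mult tc d_def[symmetric] by simp
  next
    case False
    then show ?thesis by (auto simp: H_coeff_def tree_count_def)
  qed
qed

text \<open>The range consists of the \<open>r\<close> with \<open>m + r \<le> 2 * N\<close> and
  \<open>k + r \<le> N + 1\<close>; outside it the binomial part or \<open>tree_count\<close>
  vanishes. It is stated over the integers because \<open>N - k + 1\<close> can be negative, which
  leaves an empty sum.\<close>

lemma H_formula:
  fixes t :: "'a :: field_char_0"
  assumes "N > 0" and \<alpha>: "composition \<alpha> m k"
  shows "H N \<alpha> (t + of_nat k) =
    of_nat N * (\<Sum>r | int r \<le> min (2 * int N - int m) (int N - int k + 1).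
      (t gchoose r) * of_nat ((2 * N + k - 1) choose (2 * N - m - r)) *
      2 powi (int k + int r - int N) * (fact (2 * N - k - r) / fact (N + 1 - k - r)))"
proof -
  let ?R = "{r. int r \<le> min (2 * int N - int m) (int N - int k + 1)}"
  have R: "?R = {r. m + r \<le> 2 * N \<and> k + r \<le> N + 1}" by auto
  have km: "k = 0 \<longrightarrow> m = 0" using \<alpha> by (auto simp: composition_def)
  have "H N \<alpha> (t + of_nat k) = (\<Sum>r\<le>2 * N. (t gchoose r) * of_rat (H_coeff N m k r))"
    by (rule H_expansion[OF \<alpha> assms(1)])
  also have "\<dots> = (\<Sum>r\<in>?R. (t gchoose r) * of_rat (H_coeff N m k r))"
    unfolding R by (rule sum.mono_neutral_right) (use assms(1) km in \<open>auto simp: of_rat_H_coeff\<close>)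
  also have "\<dots> = (\<Sum>r\<in>?R. of_nat N * ((t gchoose r) * of_nat ((2 * N + k - 1) choose (2 * N - m - r)) *
      2 powi (int k + int r - int N) * (fact (2 * N - k - r) / fact (N + 1 - k - r))))"
    unfolding R by (rule sum.cong) (use assms(1) km in \<open>auto simp: of_rat_H_coeff\<close>)
  finally show ?thesis by (simp add: sum_distrib_left)
qed

section \<open>Conjugation\<close>

text \<open>Equal fibre sizes amount to equal image multisets. Both relabellings below come from
  this: of blocks by their index, and of cycles by position.\<close>

lemma permutes_matching_fibres:
  assumes S: "finite S" and eq: "\<And>y. card {x\<in>S. f x = y} = card {x\<in>S. g x = y}"
  obtains \<tau> where "\<tau> permutes S" "\<And>x. x \<in> S \<Longrightarrow> g (\<tau> x) = f x"
proof -
  have "image_mset f (mset_set S) = image_mset g (mset_set S)"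
    by (rule multiset_eqI) (simp add: count_image_mset_eq_card_vimage S eq)
  from image_mset_eq_implies_permutes[OF S this]
  obtain p where "p permutes S" "\<forall>x\<in>S. f x = g (p x)" .
  then show ?thesis using that[of p] by simp
qed

text \<open>The permutation matches up the index functions of the blocks of \<open>A\<close> and \<open>B\<close>.\<close>

lemma set_tuples_transitive:
  assumes A: "A \<in> set_tuples N \<alpha>" and B: "B \<in> set_tuples N \<alpha>"
  obtains \<tau> where "\<tau> permutes points N" "map ((`) \<tau>) A = B"
proof -
  \<comment> \<open>Points outside all blocks receive the extra index
    \<open>length \<alpha>\<close>, so that the complement is matched as one more fibre.\<close>
  define idx where "idx C x = (if \<exists>i<length \<alpha>. x \<in> C ! i then THE i. i < length \<alpha> \<and> x \<in> C ! i else length \<alpha>)"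
    for C :: "nat set list" and x
  have idx1: "idx C x = i \<longleftrightarrow> x \<in> C ! i" if C: "C \<in> set_tuples N \<alpha>" and i: "i < length \<alpha>" for C x i
  proof -
    have dis: "j = j'" if "j < length \<alpha>" "j' < length \<alpha>" "x \<in> C ! j" "x \<in> C ! j'" for j j'
    proof (rule ccontr)
      assume "j \<noteq> j'"
      then have "C ! j \<inter> C ! j' = {}" using C that by (simp add: set_tuples_def)
      then show False using that by blast
    qed
    have "idx C x = j" if "j < length \<alpha>" "x \<in> C ! j" for j
      unfolding idx_def using that dis by (auto intro!: the_equality)
    moreover have "\<exists>j<length \<alpha>. x \<in> C ! j" if "idx C x \<noteq> length \<alpha>" using that by (auto simp: idx_def split: if_splits)
    ultimately show ?thesis using i by (metis less_irrefl)
  qed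
  have idx2: "idx C x \<le> length \<alpha>" if "C \<in> set_tuples N \<alpha>" for C x
  proof (cases "\<exists>i<length \<alpha>. x \<in> C ! i")
    case True
    then obtain i where "i < length \<alpha>" "x \<in> C ! i" by auto
    then show ?thesis using idx1[OF that, of i x] by simp
  qed (auto simp: idx_def)
  have sub: "C ! i \<subseteq> points N" "card (C ! i) = \<alpha> ! i" if "C \<in> set_tuples N \<alpha>" "i < length \<alpha>" for C i
    using that by (auto simp: set_tuples_def)
  have c1: "{x\<in>points N. idx C x = i} = C ! i" if "C \<in> set_tuples N \<alpha>" "i < length \<alpha>" for C i
    using idx1[OF that] sub[OF that] by auto
  have c2: "card {x\<in>points N. idx C x = length \<alpha>} + (\<Sum>i<length \<alpha>. \<alpha> ! i) = 2 * N" if C: "C \<in> set_tuples N \<alpha>" for C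
  proof -
    have "2 * N = (\<Sum>x\<in>points N. 1)" by simp
    also have "\<dots> = (\<Sum>i\<in>{..length \<alpha>}. \<Sum>x\<in>{x\<in>points N. idx C x = i}. 1)"
      by (rule sum.group[symmetric]) (use idx2[OF C] in auto)
    also have "\<dots> = (\<Sum>i\<le>length \<alpha>. card {x\<in>points N. idx C x = i})" by simp
    also have "\<dots> = (\<Sum>i<length \<alpha>. card {x\<in>points N. idx C x = i}) + card {x\<in>points N. idx C x = length \<alpha>}"
      by (simp add: lessThan_Suc_atMost[symmetric])
    also have "(\<Sum>i<length \<alpha>. card {x\<in>points N. idx C x = i}) = (\<Sum>i<length \<alpha>. \<alpha> ! i)"
      by (rule sum.cong) (use c1[OF C] sub[OF C] in auto)
    finally show ?thesis by simp
  qed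
  have "card {x\<in>points N. idx A x = y} = card {x\<in>points N. idx B x = y}" for y
  proof (cases y "length \<alpha>" rule: linorder_cases)
    case less
    then show ?thesis using c1[OF A less] c1[OF B less] sub[OF A less] sub[OF B less] by simp
  next
    case equal
    then show ?thesis using c2[OF A] c2[OF B] by simp
  next
    case greater
    then have "{x\<in>points N. idx C x = y} = {}" if "C \<in> set_tuples N \<alpha>" for C
      using idx2[OF that] by (auto simp: not_le[symmetric])
    from this[OF A] this[OF B] show ?thesis by (simp only:)
  qed
  then obtain \<tau> where \<tau>: "\<tau> permutes points N" "\<And>x. x \<in> points N \<Longrightarrow> idx B (\<tau> x) = idx A x"
    using permutes_matching_fibres[of "points N" "idx A" "idx B"] by auto
  have "\<tau> ` (A ! i) = B ! i" if i: "i < length \<alpha>" for i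
  proof (rule card_subset_eq)
    show "finite (B ! i)" using sub[OF B i] finite_subset by auto
    show "\<tau> ` (A ! i) \<subseteq> B ! i"
    proof (rule image_subsetI)
      fix x assume "x \<in> A ! i"
      moreover then have "x \<in> points N" using sub(1)[OF A i] by blast
      ultimately show "\<tau> x \<in> B ! i" using \<tau>(2)[of x] idx1[OF A i, of x] idx1[OF B i, of "\<tau> x"] by simp
    qed
    show "card (\<tau> ` (A ! i)) = card (B ! i)"
      using sub(2)[OF A i] sub(2)[OF B i] permutes_inj_on[OF \<tau>(1)] by (simp add: card_image)
  qed
  then have "map ((`) \<tau>) A = B" using A B by (intro nth_equalityI) (auto simp: set_tuples_def)
  then show ?thesis using that \<tau>(1) by blast
qed

lemma cyclic_eq_cycle_of_list:
  assumes c: "c permutes S" "cyclic_on c S" and S: "finite S"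
  obtains xs where "distinct xs" "set xs = S" "c = cycle_of_list xs"
proof -
  obtain a where a: "a \<in> S" "S = orbit c a" using c(2) unfolding cyclic_on_def by blast
  have perm: "permutation c" using c S by (auto simp: permutation_permutes)
  let ?xs = "support c a"
  have set: "set ?xs = S" unfolding support_set[OF perm] a(2) orbit_altdef_permutation[OF perm] by auto
  moreover have "c x = cycle_of_list ?xs x" for x
  proof (cases "x \<in> S")
    case True
    then show ?thesis using cycle_restrict[OF perm, of x a] set by simp
  next
    case False
    then show ?thesis using id_outside_supp[of x ?xs] set permutes_not_in[OF c(1)] by simp
  qed
  ultimately show ?thesis using that[of ?xs] cycle_of_permutation[OF perm] by blast
qed

text \<open>Both cycles are written as lists of the same set, and \<open>\<tau>\<close> carries one
  list to the other entry by entry; it is obtained from the position functions, whose fibres have at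
  most one element.\<close>

lemma cyclic_conjugate:
  fixes c c' :: "'a \<Rightarrow> 'a"
  assumes c: "c permutes S" "cyclic_on c S" "c' permutes S" "cyclic_on c' S" and S: "finite S"
  obtains \<tau> where "\<tau> permutes S" "c' = \<tau> \<circ> c \<circ> inv \<tau>"
proof -
  obtain xs where xs: "distinct xs" "set xs = S" "c = cycle_of_list xs"
    using cyclic_eq_cycle_of_list[OF c(1,2) S] .
  obtain ys where ys: "distinct ys" "set ys = S" "c' = cycle_of_list ys"
    using cyclic_eq_cycle_of_list[OF c(3,4) S] .
  have len: "length xs = length ys" using xs ys by (metis distinct_card)
  define f where "f zs x = (THE i. i < length xs \<and> zs ! i = x)" for zs :: "'a list" and x
  have f: "f zs (zs ! i) = i" if "i < length xs" "distinct zs" "length zs = length xs" for zs i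
    unfolding f_def using that by (auto intro!: the_equality simp: nth_eq_iff_index_eq)
  have img: "{x\<in>S. f zs x = y} = (if y < length xs then {zs ! y} else {})"
    if zs: "distinct zs" "set zs = S" "length zs = length xs" for zs y
  proof -
    have "x \<in> S \<and> f zs x = y \<longleftrightarrow> y < length xs \<and> x = zs ! y" for x
    proof
      assume x: "x \<in> S \<and> f zs x = y"
      then obtain i where i: "i < length xs" "x = zs ! i" using zs by (metis in_set_conv_nth)
      then show "y < length xs \<and> x = zs ! y" using f[OF i(1) zs(1,3)] x by simp
    next
      assume "y < length xs \<and> x = zs ! y"
      then show "x \<in> S \<and> f zs x = y" using f[OF _ zs(1,3), of y] zs(2,3) nth_mem[of y zs] by simp
    qed
    then show ?thesis by auto
  qed
  have cards: "card {x\<in>S. f xs x = y} = card {x\<in>S. f ys x = y}" for y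
    using img[OF xs(1,2), of y] img[OF ys(1,2), of y] len by simp
  obtain \<tau> where \<tau>: "\<tau> permutes S" "\<And>x. x \<in> S \<Longrightarrow> f ys (\<tau> x) = f xs x"
    using permutes_matching_fibres[OF S cards] by blast
  have "map \<tau> xs = ys"
  proof (rule nth_equalityI)
    fix i assume "i < length (map \<tau> xs)"
    then have i: "i < length xs" by simp
    then have "xs ! i \<in> S" using xs by auto
    then have "\<tau> (xs ! i) \<in> S" "f ys (\<tau> (xs ! i)) = i"
      using \<tau> f[OF i xs(1)] permutes_in_image[OF \<tau>(1)] by auto
    then have "\<tau> (xs ! i) \<in> {x\<in>S. f ys x = i}" by blast
    then show "map \<tau> xs ! i = ys ! i" using img[OF ys(1,2), of i] len i by simp
  qed (use len in simp)
  then have "c' = \<tau> \<circ> c \<circ> inv \<tau>"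
    using conjugation_of_cycle[OF xs(1) permutes_bij[OF \<tau>(1)]] xs ys by simp
  then show ?thesis using that \<tau>(1) by blast
qed

lemma std_cycle_long: "N > 0 \<Longrightarrow> std_cycle N \<in> long_cycles N"
proof -
  assume N: "N > 0"
  let ?c = "std_cycle N"
  have "Suc j \<in> orbit ?c (2 * N)" if "j < 2 * N" for j
    using that
  proof (induction j)
    case 0
    have "?c (2 * N) = 1" using std_cycle_apply[of "2 * N - 1" N] N by simp
    then show ?case using orbit.base[of ?c "2 * N"] by simp
  next
    case (Suc j)
    have "?c (Suc j) = Suc (Suc j)" using std_cycle_apply[of j N] Suc.prems by simp
    then show ?case using orbit.step[of "Suc j" ?c "2 * N"] Suc by simp
  qed
  then have "points N \<subseteq> orbit ?c (2 * N)"
    by (auto, metis Suc_le_D Suc_le_lessD)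
  moreover have "2 * N \<in> points N" using N by simp
  ultimately have "cyclic_on ?c (points N)"
    unfolding cyclic_on_def using permutes_orbit_subset[OF std_cycle_permutes] by blast
  then show ?thesis using std_cycle_permutes by (simp add: long_cycles_def)
qed

definition conjugate :: "('a \<Rightarrow> 'a) \<Rightarrow> ('a \<Rightarrow> 'a) \<Rightarrow> 'a \<Rightarrow> 'a" where
  "conjugate \<tau> p = \<tau> \<circ> p \<circ> inv \<tau>"

lemma conjugate_apply: "bij \<tau> \<Longrightarrow> conjugate \<tau> p (\<tau> x) = \<tau> (p x)"
  by (simp add: conjugate_def bij_is_inj)

lemma conjugate_comp: "bij \<tau> \<Longrightarrow> conjugate \<tau> p \<circ> conjugate \<tau> q = conjugate \<tau> (p \<circ> q)"
  by (simp add: conjugate_def fun_eq_iff bij_is_inj)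

lemma inj_conjugate:
  assumes "bij \<tau>" shows "inj (conjugate \<tau>)"
proof (rule injI, rule ext)
  fix p q x assume "conjugate \<tau> p = conjugate \<tau> q"
  then have "\<tau> (p x) = \<tau> (q x)" using conjugate_apply[OF assms] by metis
  then show "p x = q x" using assms by (simp add: bij_is_inj inj_eq)
qed

lemma permutes_conjugate: "\<tau> permutes S \<Longrightarrow> p permutes S \<Longrightarrow> conjugate \<tau> p permutes S"
  unfolding conjugate_def by (intro permutes_compose permutes_inv)

lemma conjugate_matchings:
  assumes "\<tau> permutes S" "p \<in> matchings S"
  shows "conjugate \<tau> p \<in> matchings S"
proof -
  note m = matchingsD[OF assms(2)]
  have b: "bij \<tau>" by (rule permutes_bij[OF assms(1)])
  have "conjugate \<tau> p (conjugate \<tau> p y) = y \<and> conjugate \<tau> p y \<noteq> y" if y: "y \<in> S" for y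
  proof -
    obtain x where x: "x \<in> S" "y = \<tau> x" using y permutes_image[OF assms(1)] by blast
    have "p (p x) = x" "p x \<noteq> x" using m(3,4)[OF x(1)] .
    then show ?thesis using b by (simp add: x(2) conjugate_apply bij_is_inj inj_eq)
  qed
  then show ?thesis using permutes_conjugate[OF assms(1) m(1)] unfolding matchings_def by blast
qed

lemma conjugate_long_cycles:
  assumes "\<tau> permutes points N" "c \<in> long_cycles N"
  shows "conjugate \<tau> c \<in> long_cycles N"
proof -
  have "cyclic_on (conjugate \<tau> c) (\<tau> ` points N)"
    using assms permutes_bij[OF assms(1)] by (intro cyclic_on_image[of c]) (auto simp: long_cycles_def conjugate_apply)
  then show ?thesis
    using assms permutes_conjugate[OF assms(1)] permutes_image[OF assms(1)] by (simp add: long_cycles_def)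
qed

lemma map_image_set_tuples:
  assumes \<tau>: "\<tau> permutes points N" and A: "A \<in> set_tuples N \<alpha>"
  shows "map ((`) \<tau>) A \<in> set_tuples N \<alpha>"
proof -
  have inj: "inj \<tau>" by (rule permutes_inj[OF \<tau>])
  have len: "length A = length \<alpha>" using A by (simp add: set_tuples_def)
  have "\<tau> ` (A ! i) \<subseteq> points N \<and> card (\<tau> ` (A ! i)) = \<alpha> ! i" if "i < length \<alpha>" for i
  proof -
    have Ai: "A ! i \<subseteq> points N" "card (A ! i) = \<alpha> ! i" using A that by (auto simp: set_tuples_def)
    have "\<tau> ` (A ! i) \<subseteq> \<tau> ` points N" using Ai(1) by (rule image_mono)
    then show ?thesis
      using permutes_image[OF \<tau>] Ai(2) inj by (simp add: card_image inj_on_subset)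
  qed
  moreover have "\<tau> ` (A ! i) \<inter> \<tau> ` (A ! j) = {}" if "i < length \<alpha>" "j < length \<alpha>" "i \<noteq> j" for i j
    using A that len unfolding image_Int[OF inj, symmetric] by (auto simp: set_tuples_def)
  ultimately show ?thesis using len by (simp add: set_tuples_def)
qed

text \<open>The cycles of the conjugate are the images of the cycles of \<open>p\<close> under
  \<open>\<tau>\<close>, and the blocks move with them.\<close>

lemma separated_conjugate:
  assumes \<tau>: "\<tau> permutes points N" and p: "p permutes points N" and sep: "separated N A p"
  shows "separated N (map ((`) \<tau>) A) (conjugate \<tau> p)"
  unfolding separated_def
proof (intro ballI allI impI)
  have b: "bij \<tau>" by (rule permutes_bij[OF \<tau>])
  have perm: "permutation p" using p by (auto simp: permutation_permutes)
  fix C i j assume C: "C \<in> cycles_of (conjugate \<tau> p) (points N)" and ij: "i < length (map ((`) \<tau>) A)" "j < length (map ((`) \<tau>) A)"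
    and ne: "C \<inter> map ((`) \<tau>) A ! i \<noteq> {} \<and> C \<inter> map ((`) \<tau>) A ! j \<noteq> {}"
  obtain y where y: "y \<in> points N" "C = orbit (conjugate \<tau> p) y" using C by (auto simp: cycles_of_def)
  obtain x where x: "x \<in> points N" "y = \<tau> x" using y permutes_image[OF \<tau>] by blast
  have CC: "C = \<tau> ` orbit p x" unfolding y(2) x(2)
    by (rule orbit_inverse[symmetric]) (use permutation_self_in_orbit[OF perm] b in \<open>auto simp: conjugate_apply\<close>)
  have "orbit p x \<inter> A ! i \<noteq> {}" "orbit p x \<inter> A ! j \<noteq> {}"
    using ne ij unfolding CC by (auto simp: inj_image_mem_iff[OF bij_is_inj[OF b]] dest: injD[OF bij_is_inj[OF b]])
  then show "i = j" using sep x ij unfolding separated_def cycles_of_def by auto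
qed

section \<open>The separation probability\<close>

text \<open>A version of \<open>set_tuples\<close> over any ground set, so that an induction on
  \<open>\<alpha>\<close> can remove the first block from it.\<close>

definition disjoint_tuples :: "'a set \<Rightarrow> nat list \<Rightarrow> 'a set list set" where
  "disjoint_tuples S \<alpha> = {A. length A = length \<alpha> \<and>
     (\<forall>i<length A. A ! i \<subseteq> S \<and> card (A ! i) = \<alpha> ! i) \<and>
     (\<forall>i<length A. \<forall>j<length A. i \<noteq> j \<longrightarrow> A ! i \<inter> A ! j = {})}"

lemma disjoint_tuples_Nil: "disjoint_tuples S [] = {[]}"
  by (auto simp: disjoint_tuples_def)

lemma Cons_in_disjoint_tuples:
  "X # A \<in> disjoint_tuples S (a # \<alpha>) \<longleftrightarrow> X \<subseteq> S \<and> card X = a \<and> A \<in> disjoint_tuples (S - X) \<alpha>"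
proof
  assume L: "X # A \<in> disjoint_tuples S (a # \<alpha>)"
  then have len: "length A = length \<alpha>"
    and *: "\<And>i. i < Suc (length \<alpha>) \<Longrightarrow> (X # A) ! i \<subseteq> S \<and> card ((X # A) ! i) = (a # \<alpha>) ! i"
    and **: "\<And>i j. i < Suc (length \<alpha>) \<Longrightarrow> j < Suc (length \<alpha>) \<Longrightarrow> i \<noteq> j \<Longrightarrow> (X # A) ! i \<inter> (X # A) ! j = {}"
    by (simp_all add: disjoint_tuples_def)
  have "A ! i \<subseteq> S - X \<and> card (A ! i) = \<alpha> ! i" if "i < length \<alpha>" for i
    using *[of "Suc i"] **[of "Suc i" 0] that by auto
  moreover have "A ! i \<inter> A ! j = {}" if "i < length \<alpha>" "j < length \<alpha>" "i \<noteq> j" for i j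
    using **[of "Suc i" "Suc j"] that by simp
  ultimately show "X \<subseteq> S \<and> card X = a \<and> A \<in> disjoint_tuples (S - X) \<alpha>"
    using *[of 0] len by (simp add: disjoint_tuples_def)
next
  assume R: "X \<subseteq> S \<and> card X = a \<and> A \<in> disjoint_tuples (S - X) \<alpha>"
  then have len: "length A = length \<alpha>"
    and *: "\<And>i. i < length \<alpha> \<Longrightarrow> A ! i \<subseteq> S - X \<and> card (A ! i) = \<alpha> ! i"
    and **: "\<And>i j. i < length \<alpha> \<Longrightarrow> j < length \<alpha> \<Longrightarrow> i \<noteq> j \<Longrightarrow> A ! i \<inter> A ! j = {}"
    by (simp_all add: disjoint_tuples_def)
  have "(X # A) ! i \<subseteq> S \<and> card ((X # A) ! i) = (a # \<alpha>) ! i" if "i < Suc (length \<alpha>)" for i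
    using that R *[of "i - 1"] by (cases i) auto
  moreover have "(X # A) ! i \<inter> (X # A) ! j = {}" if "i < Suc (length \<alpha>)" "j < Suc (length \<alpha>)" "i \<noteq> j" for i j
    using that *[of "i - 1"] *[of "j - 1"] **[of "i - 1" "j - 1"] by (cases i; cases j) auto
  ultimately show "X # A \<in> disjoint_tuples S (a # \<alpha>)"
    using len by (simp add: disjoint_tuples_def)
qed

lemma disjoint_tuples_Cons:
  "disjoint_tuples S (a # \<alpha>) = (\<lambda>(X, A). X # A) ` (SIGMA X:{X. X \<subseteq> S \<and> card X = a}. disjoint_tuples (S - X) \<alpha>)"
    (is "?L = ?R")
proof (intro set_eqI iffI)
  fix A assume A: "A \<in> ?L"
  then have "length A = Suc (length \<alpha>)" by (simp add: disjoint_tuples_def)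
  then obtain X A' where "A = X # A'" by (auto simp: length_Suc_conv)
  then show "A \<in> ?R" using A by (auto simp: Cons_in_disjoint_tuples)
qed (auto simp: Cons_in_disjoint_tuples)

lemma finite_disjoint_tuples: "finite S \<Longrightarrow> finite (disjoint_tuples S \<alpha>)"
  by (induction \<alpha> arbitrary: S) (auto simp: disjoint_tuples_Nil disjoint_tuples_Cons)

text \<open>Choosing the first block and then the others in its complement builds up the multinomial
  coefficient, stated here without division.\<close>

lemma card_disjoint_tuples:
  assumes "finite S" "sum_list \<alpha> \<le> card S"
  shows "card (disjoint_tuples S \<alpha>) * (prod_list (map fact \<alpha>) * fact (card S - sum_list \<alpha>)) = fact (card S)"
  using assms
proof (induction \<alpha> arbitrary: S)
  case Nil
  then show ?case by (simp add: disjoint_tuples_Nil)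
next
  case (Cons a \<alpha>)
  let ?P = "prod_list (map fact \<alpha>) * fact (card S - sum_list (a # \<alpha>))"
  let ?X = "{X. X \<subseteq> S \<and> card X = a}"
  have "card (disjoint_tuples S (a # \<alpha>)) = card (SIGMA X:?X. disjoint_tuples (S - X) \<alpha>)"
    unfolding disjoint_tuples_Cons by (rule card_image) (auto simp: inj_on_def)
  also have "\<dots> = (\<Sum>X\<in>?X. card (disjoint_tuples (S - X) \<alpha>))"
    using Cons.prems by (simp add: finite_disjoint_tuples)
  finally have "card (disjoint_tuples S (a # \<alpha>)) * ?P = (\<Sum>X\<in>?X. card (disjoint_tuples (S - X) \<alpha>) * ?P)"
    by (simp add: sum_distrib_right)
  also have "\<dots> = (\<Sum>X\<in>?X. fact (card S - a))"
  proof (rule sum.cong[OF refl])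
    fix X assume "X \<in> ?X"
    then have "card (S - X) = card S - a"
      using Cons.prems(1) by (auto intro!: card_Diff_subset intro: finite_subset)
    then show "card (disjoint_tuples (S - X) \<alpha>) * ?P = fact (card S - a)"
      using Cons.IH[of "S - X"] Cons.prems by simp
  qed
  also have "\<dots> = (card S choose a) * fact (card S - a)"
    using n_subsets[OF Cons.prems(1), of a] by simp
  finally have "card (disjoint_tuples S (a # \<alpha>)) * (fact a * ?P) = fact a * fact (card S - a) * (card S choose a)"
    by (simp add: algebra_simps)
  also have "\<dots> = fact (card S)" using Cons.prems by (intro binomial_fact_lemma) simp
  finally show ?case by (simp add: algebra_simps)
qed

lemma card_set_tuples:
  assumes "composition \<alpha> m k" "m \<le> 2 * N"
  shows "card (set_tuples N \<alpha>) * ((\<Prod>i<k. fact (\<alpha> ! i)) * fact (2 * N - m)) = fact (2 * N)"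
proof -
  have \<alpha>: "length \<alpha> = k" "sum_list \<alpha> = m" using assms by (auto simp: composition_def)
  have "prod_list (map fact \<beta>) = (\<Prod>i<length \<beta>. fact (\<beta> ! i) :: nat)" for \<beta> :: "nat list"
    by (induction \<beta>) (simp_all add: prod.lessThan_Suc_shift del: prod.lessThan_Suc)
  then have "prod_list (map fact \<alpha>) = (\<Prod>i<k. fact (\<alpha> ! i) :: nat)" using \<alpha>(1) by simp
  moreover have "set_tuples N \<alpha> = disjoint_tuples (points N) \<alpha>" by (simp add: set_tuples_def disjoint_tuples_def)
  ultimately show ?thesis using card_disjoint_tuples[of "points N" \<alpha>] assms(2) \<alpha> by simp
qed

lemma pair_pmf_of_set:
  assumes "finite A" "A \<noteq> {}" "finite B" "B \<noteq> {}"
  shows "pair_pmf (pmf_of_set A) (pmf_of_set B) = pmf_of_set (A \<times> B)"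
proof (rule pmf_eqI)
  fix x
  show "pmf (pair_pmf (pmf_of_set A) (pmf_of_set B)) x = pmf (pmf_of_set (A \<times> B)) x"
    using assms by (cases x) (simp add: pmf_pair indicator_def card_cartesian_product)
qed

text \<open>Conjugation by a \<open>\<tau>\<close> that carries \<open>c\<close> to
  \<open>c'\<close> is injective on the pairs. The inequality is enough, since \<open>c\<close> and
  \<open>c'\<close> can be exchanged.\<close>

lemma card_separated_pairs_invariant:
  assumes c: "c \<in> long_cycles N" and c': "c' \<in> long_cycles N"
  shows "card {(\<pi>, A). \<pi> \<in> fpf_involutions N \<and> A \<in> set_tuples N \<alpha> \<and> separated N A (\<pi> \<circ> c)} \<le>
    card {(\<pi>, A). \<pi> \<in> fpf_involutions N \<and> A \<in> set_tuples N \<alpha> \<and> separated N A (\<pi> \<circ> c')}" (is "card (?E c) \<le> card (?E c')")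
proof -
  obtain \<tau> where \<tau>: "\<tau> permutes points N" "c' = \<tau> \<circ> c \<circ> inv \<tau>"
    using cyclic_conjugate[of c "points N" c'] c c' by (auto simp: long_cycles_def)
  have b: "bij \<tau>" by (rule permutes_bij[OF \<tau>(1)])
  have c'_eq: "c' = conjugate \<tau> c" using \<tau>(2) by (simp add: conjugate_def)
  let ?g = "\<lambda>(\<pi>, A). (conjugate \<tau> \<pi>, map ((`) \<tau>) A)"
  show ?thesis
  proof (rule card_inj_on_le[of ?g])
    have "inj ((`) \<tau>)" by (rule injI) (simp add: inj_image_eq_iff bij_is_inj[OF b])
    then have "inj (map ((`) \<tau>))" by (rule inj_mapI)
    then have "inj ?g"
      using prod.inj_map[OF inj_conjugate[OF b]] unfolding map_prod_def by blast
    then show "inj_on ?g (?E c)" by (rule inj_on_subset) simp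
    show "?g ` ?E c \<subseteq> ?E c'"
    proof (rule image_subsetI)
      fix x assume x: "x \<in> ?E c"
      obtain \<pi> A where xp: "x = (\<pi>, A)" by (cases x)
      then have *: "\<pi> \<in> matchings (points N)" "A \<in> set_tuples N \<alpha>" "separated N A (\<pi> \<circ> c)"
        using x by (simp_all only: mem_Collect_eq case_prod_conv fpf_involutions_eq)
      have "\<pi> \<circ> c permutes points N"
        using *(1) c by (intro permutes_compose) (auto simp: matchings_def long_cycles_def)
      then have "separated N (map ((`) \<tau>) A) (conjugate \<tau> \<pi> \<circ> c')"
        unfolding c'_eq conjugate_comp[OF b] using *(3) by (rule separated_conjugate[OF \<tau>(1)])
      then show "?g x \<in> ?E c'"
        using conjugate_matchings[OF \<tau>(1) *(1)] map_image_set_tuples[OF \<tau>(1) *(2)] xp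
        by (simp only: mem_Collect_eq case_prod_conv fpf_involutions_eq)
    qed
    show "finite (?E c')"
      by (rule finite_subset[of _ "fpf_involutions N \<times> set_tuples N \<alpha>"])
        (auto simp: fpf_involutions_eq finite_matchings finite_set_tuples)
  qed
qed

text \<open>Conjugation by a \<open>\<tau>\<close> that carries \<open>A\<close> to \<open>B\<close>
  preserves the set of long cycles, so the probability does not depend on the chosen tuple; again
  one direction suffices.\<close>

lemma card_separated_products_invariant:
  assumes A: "A \<in> set_tuples N \<alpha>" and B: "B \<in> set_tuples N \<alpha>"
  shows "card {(\<pi>, c). \<pi> \<in> fpf_involutions N \<and> c \<in> long_cycles N \<and> separated N A (\<pi> \<circ> c)} \<le>
    card {(\<pi>, c). \<pi> \<in> fpf_involutions N \<and> c \<in> long_cycles N \<and> separated N B (\<pi> \<circ> c)}" (is "card (?E A) \<le> card (?E B)")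
proof -
  obtain \<tau> where \<tau>: "\<tau> permutes points N" "map ((`) \<tau>) A = B" using set_tuples_transitive[OF A B] .
  have b: "bij \<tau>" by (rule permutes_bij[OF \<tau>(1)])
  let ?g = "\<lambda>(\<pi>, c). (conjugate \<tau> \<pi>, conjugate \<tau> c)"
  show ?thesis
  proof (rule card_inj_on_le[of ?g])
    have "inj ?g"
      using prod.inj_map[OF inj_conjugate[OF b] inj_conjugate[OF b]] unfolding map_prod_def .
    then show "inj_on ?g (?E A)" by (rule inj_on_subset) simp
    show "?g ` ?E A \<subseteq> ?E B"
    proof (rule image_subsetI)
      fix x assume x: "x \<in> ?E A"
      obtain \<pi> c where xp: "x = (\<pi>, c)" by (cases x)
      then have *: "\<pi> \<in> matchings (points N)" "c \<in> long_cycles N" "separated N A (\<pi> \<circ> c)"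
        using x by (simp_all only: mem_Collect_eq case_prod_conv fpf_involutions_eq)
      have "\<pi> \<circ> c permutes points N"
        using *(1,2) by (intro permutes_compose) (auto simp: matchings_def long_cycles_def)
      then have "separated N B (conjugate \<tau> \<pi> \<circ> conjugate \<tau> c)"
        unfolding \<tau>(2)[symmetric] conjugate_comp[OF b] using *(3) by (rule separated_conjugate[OF \<tau>(1)])
      then show "?g x \<in> ?E B"
        using conjugate_matchings[OF \<tau>(1) *(1)] conjugate_long_cycles[OF \<tau>(1) *(2)] xp
        by (simp only: mem_Collect_eq case_prod_conv fpf_involutions_eq)
    qed
    show "finite (?E B)"
      by (rule finite_subset[of _ "fpf_involutions N \<times> long_cycles N"])
        (auto simp: fpf_involutions_eq finite_matchings long_cycles_def finite_permutations)
  qed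
qed

lemma H_1: "H N \<alpha> 1 = of_nat (card (separated_pairs N \<alpha>))"
  by (simp add: H_def case_prod_beta)

text \<open>Double counting of the triples \<open>(\<pi>, c, A)\<close> for which \<open>\<pi> \<circ> c\<close> is \<open>A\<close>-separated.\<close>

lemma sep_prob_eq:
  assumes N: "N > 0" and A: "A \<in> set_tuples N \<alpha>"
  shows "sep_prob N A = H N \<alpha> 1 / (real (card (set_tuples N \<alpha>)) * real (double_fact (2 * N - 1)))"
proof -
  let ?P = "fpf_involutions N" and ?C = "long_cycles N" and ?T = "set_tuples N \<alpha>"
  define Z where "Z B = card {(\<pi>, c). \<pi> \<in> ?P \<and> c \<in> ?C \<and> separated N B (\<pi> \<circ> c)}" for B
  define Y where "Y c = card {(\<pi>, B). \<pi> \<in> ?P \<and> B \<in> ?T \<and> separated N B (\<pi> \<circ> c)}" for c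
  have fin: "finite ?P" "finite ?C" "finite ?T"
    by (auto simp: fpf_involutions_eq finite_matchings finite_set_tuples long_cycles_def finite_permutations)
  have cP: "card ?P = double_fact (2 * N - 1)" unfolding fpf_involutions_eq by (rule card_matchings) auto
  have df: "double_fact n > 0" for n by (induction n rule: double_fact.induct) auto
  then have neP: "?P \<noteq> {}" using cP by (metis card.empty less_irrefl)
  have neC: "?C \<noteq> {}" using std_cycle_long[OF N] by auto
  have Zs: "Z B = (\<Sum>\<pi>\<in>?P. \<Sum>c\<in>?C. of_bool (separated N B (\<pi> \<circ> c)))" for B
  proof -
    have "{(\<pi>, c). \<pi> \<in> ?P \<and> c \<in> ?C \<and> separated N B (\<pi> \<circ> c)} = (SIGMA \<pi>:?P. {c\<in>?C. separated N B (\<pi> \<circ> c)})" by auto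
    then show ?thesis using fin by (simp add: Z_def card_eq_sum_of_bool)
  qed
  have Ys: "Y c = (\<Sum>\<pi>\<in>?P. \<Sum>B\<in>?T. of_bool (separated N B (\<pi> \<circ> c)))" for c
  proof -
    have "{(\<pi>, B). \<pi> \<in> ?P \<and> B \<in> ?T \<and> separated N B (\<pi> \<circ> c)} = (SIGMA \<pi>:?P. {B\<in>?T. separated N B (\<pi> \<circ> c)})" by auto
    then show ?thesis using fin by (simp add: Y_def card_eq_sum_of_bool)
  qed
  \<comment> \<open>The triples number \<open>card ?T * Z A\<close> when sorted by tuple, and
    \<open>card ?C * Y (std_cycle N)\<close> when sorted by long cycle.\<close>
  have "Z B = Z A" if "B \<in> ?T" for B
    unfolding Z_def using that A by (intro antisym card_separated_products_invariant)
  then have "card ?T * Z A = (\<Sum>B\<in>?T. Z B)" by simp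
  also have "\<dots> = (\<Sum>\<pi>\<in>?P. \<Sum>c\<in>?C. \<Sum>B\<in>?T. of_bool (separated N B (\<pi> \<circ> c)))"
    unfolding Zs by (subst sum.swap, rule sum.cong[OF refl], rule sum.swap)
  also have "\<dots> = (\<Sum>c\<in>?C. Y c)" unfolding Ys by (rule sum.swap)
  also have "\<dots> = (\<Sum>c\<in>?C. Y (std_cycle N))"
    unfolding Y_def using std_cycle_long[OF N]
    by (intro sum.cong refl antisym card_separated_pairs_invariant)
  also have "Y (std_cycle N) = card (separated_pairs N \<alpha>)" by (simp add: Y_def separated_pairs_def)
  finally have "card ?T * Z A = card ?C * card (separated_pairs N \<alpha>)" by simp
  then have eq: "real (card ?T) * real (Z A) = real (card ?C) * H N \<alpha> 1"
    unfolding H_1 by (metis of_nat_mult)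
  have "sep_prob N A = real (card ((?P \<times> ?C) \<inter> {(\<pi>, c). separated N A (\<pi> \<circ> c)})) / real (card (?P \<times> ?C))"
    unfolding sep_prob_def pair_pmf_of_set[OF fin(1) neP fin(2) neC]
    by (rule measure_pmf_of_set) (use fin neP neC in auto)
  also have "(?P \<times> ?C) \<inter> {(\<pi>, c). separated N A (\<pi> \<circ> c)} = {(\<pi>, c). \<pi> \<in> ?P \<and> c \<in> ?C \<and> separated N A (\<pi> \<circ> c)}" by auto
  finally have "sep_prob N A = real (Z A) / (real (double_fact (2 * N - 1)) * real (card ?C))"
    by (simp add: Z_def cP card_cartesian_product)
  moreover have "card ?T > 0" "card ?C > 0" using A fin neC by (auto simp: card_gt_0_iff)
  moreover from this have "real (Z A) = real (card ?C) * H N \<alpha> 1 / real (card ?T)"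
    using eq by (simp add: field_simps)
  ultimately show ?thesis by simp
qed

theorem theorem3p8:
  fixes N m k :: nat and \<alpha> :: "nat list" and t :: "'a :: field_char_0"
  assumes "N \<ge> 1" and "composition \<alpha> m k" and "m \<le> 2 * N"
  shows "(H N \<alpha> (t + of_nat k) =
           of_nat N * (\<Sum>r | int r \<le> min (2 * int N - int m) (int N - int k + 1).
             (t gchoose r) * of_nat ((2 * N + k - 1) choose (2 * N - m - r)) *
             2 powi (int k + int r - int N) * (fact (2 * N - k - r) / fact (N + 1 - k - r))))
         \<and> (\<forall>A\<in>set_tuples N \<alpha>. sep_prob N A =
           real (\<Prod>i<k. fact (\<alpha> ! i)) * fact (2 * N - m) /
             (fact (2 * N - 1) * real (double_fact (2 * N - 1))) *
           (\<Sum>r | int r \<le> min (2 * int N - int m) (int N - int k + 1).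
             ((1 - real k) gchoose r) * real ((2 * N + k - 1) choose (2 * N - m - r)) *
             2 powi (int k + int r - int N - 1) * (fact (2 * N - k - r) / fact (N + 1 - k - r))))"
proof (intro conjI ballI)
  have N: "N > 0" using assms by simp
  show "H N \<alpha> (t + of_nat k) =
           of_nat N * (\<Sum>r | int r \<le> min (2 * int N - int m) (int N - int k + 1).
             (t gchoose r) * of_nat ((2 * N + k - 1) choose (2 * N - m - r)) *
             2 powi (int k + int r - int N) * (fact (2 * N - k - r) / fact (N + 1 - k - r)))"
    by (rule H_formula[OF N assms(2)])
  fix A assume A: "A \<in> set_tuples N \<alpha>"
  define F where "F = real (\<Prod>i<k. fact (\<alpha> ! i)) * fact (2 * N - m)"
  define S where "S = (\<Sum>r | int r \<le> min (2 * int N - int m) (int N - int k + 1).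
             ((1 - real k) gchoose r) * real ((2 * N + k - 1) choose (2 * N - m - r)) *
             2 powi (int k + int r - int N - 1) * (fact (2 * N - k - r) / fact (N + 1 - k - r)))"
  \<comment> \<open>The exponent of 2 in the probability is lower by one; the resulting 2 cancels
    the one in \<open>(2N)! = 2N * (2N - 1)!\<close>.\<close>
  have half: "2 powi (z - 1) = (2 powi z :: real) / 2" for z by (simp add: power_int_diff)
  have "2 * S = (\<Sum>r | int r \<le> min (2 * int N - int m) (int N - int k + 1).
             ((1 - real k) gchoose r) * real ((2 * N + k - 1) choose (2 * N - m - r)) *
             2 powi (int k + int r - int N) * (fact (2 * N - k - r) / fact (N + 1 - k - r)))"
    unfolding S_def sum_distrib_left half by (rule sum.cong[OF refl]) simp
  \<comment> \<open>At \<open>t = 1 - k\<close> the argument of \<open>H\<close> is 1, where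
    \<open>H\<close> merely counts separated pairs.\<close>
  then have H1: "H N \<alpha> (1 :: real) = real N * (2 * S)"
    using H_formula[OF N assms(2), of "1 - real k"] by (simp only: diff_add_cancel)
  \<comment> \<open>The factor \<open>fact (2 * N - m)\<close> in \<open>F\<close> belongs to the
    points outside all blocks.\<close>
  have "real (card (set_tuples N \<alpha>)) * F = fact (2 * N)"
    using arg_cong[OF card_set_tuples[OF assms(2,3)], of real] unfolding F_def by simp
  also have "\<dots> = 2 * real N * fact (2 * N - 1)" using N by (simp add: fact_reduce)
  finally have T: "real (card (set_tuples N \<alpha>)) * F = 2 * real N * fact (2 * N - 1)" .
  have "F \<noteq> 0" by (simp add: F_def)
  then have "real (card (set_tuples N \<alpha>)) = 2 * real N * fact (2 * N - 1) / F" using T by (simp add: field_simps)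
  then have "sep_prob N A = F / (fact (2 * N - 1) * real (double_fact (2 * N - 1))) * S"
    unfolding sep_prob_eq[OF N A] H1 using N by (simp add: field_simps)
  then show "sep_prob N A = real (\<Prod>i<k. fact (\<alpha> ! i)) * fact (2 * N - m) /
             (fact (2 * N - 1) * real (double_fact (2 * N - 1))) *
           (\<Sum>r | int r \<le> min (2 * int N - int m) (int N - int k + 1).
             ((1 - real k) gchoose r) * real ((2 * N + k - 1) choose (2 * N - m - r)) *
             2 powi (int k + int r - int N - 1) * (fact (2 * N - k - r) / fact (N + 1 - k - r)))"
    unfolding F_def S_def .
qed

end
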